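(* Let $G=(V,E)$ be a connected simple undirected graph on $V=\{1,\dots,n\}$ with degree matrix $D$, adjacency matrix $A$, and $\mathrm{vol}(G)=\sum_{k\in V}\deg(k)$. Let $0=\lambda_0<\lambda_1\le\cdots\le\lambda_{n-1}$ be the eigenvalues of the normalized Laplacian $\mathcal{L}=I-D^{-1/2}AD^{-1/2}$, with corresponding orthonormal eigenvectors $\phi_0,\dots,\phi_{n-1}$, and write $\phi_{ki}$ for the $i$-th component of $\phi_k$. For each $i\in V$ let $i'\in V$ be a vertex with $H(i',i)=\max_{j\in V}H(j,i)$. Then $$\mathbb{G}(i,j)=\sqrt{\frac{\deg(j)}{\deg(i)}}\sum_{k=1}^{n-1}\frac{1}{\lambda_k}\phi_{ki}\phi_{kj},$$ $$T_{\rm mix}=\max_{i\in V}\; -\frac{\mathrm{vol}(G)}{\sqrt{\deg(i)\deg(i')}}\sum_{k=1}^{n-1}\frac{1}{\lambda_k}\phi_{ki}\phi_{ki'},$$ $$T_{\rm reset}=-\sum_{i\in V}\sqrt{\frac{\deg(i)}{\deg(i')}}\sum_{k=1}^{n-1}\frac{1}{\lambda_k}\phi_{ki}\phi_{ki'},$$ $$T_{\rm hit}=\sum_{k=1}^{n-1}\frac{1}{\lambda_k}.$$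
   Context: The simple random walk on $G$ has transition matrix $P=D^{-1}A$ and stationary distribution $\pi_i=\deg(i)/\mathrm{vol}(G)$. $H(i,j)$ is the expected number of steps for the walk started at $i$ to first reach $j$ ($H(i,i)=0$). The discrete Green's function $\mathbb{G}$ is the unique $n\times n$ matrix with $\mathbb{G}(I-D^{-1}A)=I-\mathbf{1}\pi^{\top}$ and $\mathbb{G}\mathbf{1}=\mathbf{0}$. A stopping rule from $i$ to $\pi$ is a (possibly randomized) stopping time for the walk started at $i$ such that the vertex at which the walk is stopped has distribution $\pi$; $H(i,\pi)$ denotes the minimum expected length of such a rule. Then $T_{\rm mix}=\max_{i\in V}H(i,\pi)$, $T_{\rm reset}=\sum_{i\in V}\pi_iH(i,\pi)$, and $T_{\rm hit}=\sum_{i,k\in V}\pi_i\pi_kH(i,k)$. *)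

theory Defs
  imports "HOL-Probability.Probability"
begin

text \<open>A simple undirected graph on the finite vertex set \<open>UNIV :: 'n set\<close> is given by its adjacency
  relation.\<close>

definition simple_graph :: "('n \<Rightarrow> 'n \<Rightarrow> bool) \<Rightarrow> bool" where
  "simple_graph E \<longleftrightarrow> symp E \<and> irreflp E"

definition connected_graph :: "('n \<Rightarrow> 'n \<Rightarrow> bool) \<Rightarrow> bool" where
  "connected_graph E \<longleftrightarrow> (\<forall>u v. E\<^sup>*\<^sup>* u v)"

definition deg :: "('n::finite \<Rightarrow> 'n \<Rightarrow> bool) \<Rightarrow> 'n \<Rightarrow> nat" where
  "deg E i = card {j. E i j}"

definition vol :: "('n::finite \<Rightarrow> 'n \<Rightarrow> bool) \<Rightarrow> nat" where
  "vol E = (\<Sum>k\<in>UNIV. deg E k)"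

definition diag :: "('n::finite \<Rightarrow> real) \<Rightarrow> real^'n^'n" where
  "diag d = (\<chi> i j. if i = j then d i else 0)"

definition adjacency :: "('n::finite \<Rightarrow> 'n \<Rightarrow> bool) \<Rightarrow> real^'n^'n" where
  "adjacency E = (\<chi> i j. if E i j then 1 else 0)"

text \<open>\<open>P = D\<^sup>-\<^sup>1 A\<close> and \<open>\<L> = I - D\<^sup>-\<^sup>1\<^sup>/\<^sup>2 A D\<^sup>-\<^sup>1\<^sup>/\<^sup>2\<close>, where \<open>D\<close> is the diagonal matrix of degrees.\<close>

definition transition :: "('n::finite \<Rightarrow> 'n \<Rightarrow> bool) \<Rightarrow> real^'n^'n" where
  "transition E = diag (\<lambda>i. 1 / real (deg E i)) ** adjacency E"

definition normalized_laplacian :: "('n::finite \<Rightarrow> 'n \<Rightarrow> bool) \<Rightarrow> real^'n^'n" where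
  "normalized_laplacian E =
     mat 1 - diag (\<lambda>i. 1 / sqrt (deg E i)) ** adjacency E ** diag (\<lambda>i. 1 / sqrt (deg E i))"

definition stationary :: "('n::finite \<Rightarrow> 'n \<Rightarrow> bool) \<Rightarrow> real^'n" where
  "stationary E = (\<chi> i. real (deg E i) / real (vol E))"

definition green :: "('n::finite \<Rightarrow> 'n \<Rightarrow> bool) \<Rightarrow> real^'n^'n" where
  "green E = (THE G. G ** (mat 1 - transition E) = mat 1 - (\<chi> i j. stationary E $ j) \<and> G *v 1 = 0)"


text \<open>The law of the walk \<open>X\<^sub>0, X\<^sub>1, \<dots>\<close> started at \<open>i\<close> is a measure on trajectories \<open>nat \<Rightarrow> 'n\<close>, obtained
  from the one-step kernels by the Ionescu-Tulcea theorem.\<close>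

definition step :: "('n::finite \<Rightarrow> 'n \<Rightarrow> bool) \<Rightarrow> 'n \<Rightarrow> 'n pmf" where
  "step E v = embed_pmf (\<lambda>w. transition E $ v $ w)"

definition walk_kernel ::
  "('n::finite \<Rightarrow> 'n \<Rightarrow> bool) \<Rightarrow> 'n \<Rightarrow> nat \<Rightarrow> (nat \<Rightarrow> 'n) \<Rightarrow> 'n measure" where
  "walk_kernel E i t x =
     measure_pmf (case t of 0 \<Rightarrow> return_pmf i | Suc s \<Rightarrow> step E (x s))"

definition walk :: "('n::finite \<Rightarrow> 'n \<Rightarrow> bool) \<Rightarrow> 'n \<Rightarrow> (nat \<Rightarrow> 'n) measure" where
  "walk E i = projective_family.lim UNIV
     (Ionescu_Tulcea.CI (walk_kernel E i) (\<lambda>_. count_space UNIV)) (\<lambda>_. count_space UNIV)"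

lemma Ionescu_Tulcea_walk: "Ionescu_Tulcea (walk_kernel E i) (\<lambda>_. count_space UNIV)"
proof (rule Ionescu_Tulcea.intro)
  fix t
  show "walk_kernel E i t \<in> PiM {0..<t} (\<lambda>_. count_space UNIV) \<rightarrow>\<^sub>M subprob_algebra (count_space UNIV)"
  proof (cases t)
    case 0
    then show ?thesis by (simp add: walk_kernel_def [abs_def] measure_pmf_in_subprob_algebra)
  next
    case (Suc s)
    have "(\<lambda>v. measure_pmf (step E v)) \<in> count_space UNIV \<rightarrow>\<^sub>M subprob_algebra (count_space UNIV)"
      by (simp add: measure_pmf_in_subprob_algebra)
    moreover have "(\<lambda>x. x s) \<in> PiM {0..<t} (\<lambda>_. count_space UNIV) \<rightarrow>\<^sub>M (count_space UNIV :: 'a measure)"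
      by (rule measurable_component_singleton) (simp add: Suc)
    ultimately have "(\<lambda>x. measure_pmf (step E (x s))) \<in>
        PiM {0..<t} (\<lambda>_. count_space UNIV) \<rightarrow>\<^sub>M subprob_algebra (count_space UNIV)"
      by (rule measurable_compose [rotated])
    then show ?thesis by (simp add: walk_kernel_def [abs_def] Suc)
  qed
qed (auto simp: walk_kernel_def intro: measure_pmf.prob_space_axioms)

lemma pmf_step:
  assumes "0 < deg E v"
  shows "pmf (step E v) w = transition E $ v $ w"
proof -
  have tr: "transition E $ v $ w = (if E v w then 1 / deg E v else 0)" for w
    unfolding transition_def diag_def adjacency_def matrix_matrix_mult_def
    by (simp add: if_distrib [where f = "\<lambda>x. x * _"] sum.delta cong: if_cong)
  have "(\<Sum>w\<in>UNIV. transition E $ v $ w) = 1"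
    using assms card_gt_0_iff [of "{j. E v j}"] by (simp add: tr deg_def flip: sum.inter_filter)
  moreover have "0 \<le> transition E $ v $ w" for w by (simp add: tr)
  ultimately show ?thesis
    unfolding step_def
    by (subst pmf_embed_pmf) (simp_all add: nn_integral_count_space_finite sum_nonneg)
qed

lemma emeasure_walk_cylinder:
  "emeasure (walk E i) {x. \<forall>t\<le>n. x t = y t} =
    of_bool (y 0 = i) * (\<Prod>t<n. ennreal (pmf (step E (y t)) (y (Suc t))))"
proof -
  interpret IT: Ionescu_Tulcea "walk_kernel E i" "\<lambda>_. count_space UNIV"
    by (rule Ionescu_Tulcea_walk)
  let ?M = "\<lambda>n. PiM {0..<n} (\<lambda>_. count_space UNIV) :: (nat \<Rightarrow> 'a) measure"
  let ?A = "\<lambda>n. PiE {0..<n} (\<lambda>t. {y t})"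
  have A: "?A n \<in> sets (?M n)" for n
    by (rule sets_PiM_I_finite) auto
  have eP: "emeasure (IT.eP n x) (?A (Suc n)) =
      emeasure (walk_kernel E i n x) {y n} * indicator (?A n) x" if x: "x \<in> space (?M n)" for n x
  proof -
    have "(fun_upd x n -` ?A (Suc n)) \<inter> space (count_space UNIV) =
        (if x \<in> ?A n then {y n} else {})"
      using x by (auto simp: PiE_iff extensional_def space_PiM less_Suc_eq split: if_splits)
    then show ?thesis
      by (simp add: IT.emeasure_eP [OF x A])
  qed
  have u: "(\<lambda>_. undefined) \<in> space (?M 0)" by (simp add: space_PiM)
  have C: "emeasure (IT.C 0 n (\<lambda>_. undefined)) (?A n) =
    (\<Prod>t<n. emeasure (walk_kernel E i t y) {y t})" for n
  proof (induction n)
    case 0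
    show ?case by (simp add: PiM_empty)
  next
    case (Suc n)
    let ?C = "IT.C 0 n (\<lambda>_. undefined)"
    have sp: "space ?C = space (?M n)" and se: "sets ?C = sets (?M n)"
      using IT.space_C [OF u] IT.sets_C [OF u] by auto
    have "emeasure (IT.C 0 (Suc n) (\<lambda>_. undefined)) (?A (Suc n)) =
        (\<integral>\<^sup>+x. emeasure (IT.eP n x) (?A (Suc n)) \<partial>?C)"
      using IT.measurable_eP [of n] A [of "Suc n"] IT.non_empty
      by (simp, subst emeasure_bind [where N = "?M (Suc n)"])
        (simp_all add: sp se measurable_cong_sets [OF se refl] space_PiM PiE_eq_empty_iff)
    also have "\<dots> = (\<integral>\<^sup>+x. emeasure (walk_kernel E i n y) {y n} * indicator (?A n) x \<partial>?C)"
    proof (rule nn_integral_cong)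
      fix x assume "x \<in> space ?C"
      then have x: "x \<in> space (?M n)" by (simp add: sp)
      have "walk_kernel E i n x = walk_kernel E i n y" if "x \<in> ?A n"
        using that by (cases n) (auto simp: walk_kernel_def PiE_iff)
      then show "emeasure (IT.eP n x) (?A (Suc n)) =
          emeasure (walk_kernel E i n y) {y n} * indicator (?A n) x"
        by (auto simp: eP [OF x] split: split_indicator)
    qed
    also have "\<dots> = emeasure (walk_kernel E i n y) {y n} * emeasure ?C (?A n)"
      using A [of n] by (simp add: nn_integral_cmult_indicator se)
    finally show ?case by (simp add: Suc.IH mult.commute)
  qed
  have "{x. \<forall>t\<le>n. x t = y t} = prod_emb UNIV (\<lambda>_. count_space UNIV) {0..<Suc n} (?A (Suc n))"
    by (auto simp: prod_emb_def space_PiM PiE_iff less_Suc_eq_le)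
  then have "emeasure (walk E i) {x. \<forall>t\<le>n. x t = y t} =
      emeasure (IT.CI {0..<Suc n}) (?A (Suc n))"
    unfolding walk_def using IT.lim [OF _ A [of "Suc n"]] by simp
  also have "\<dots> = emeasure (IT.C 0 (Suc n) (\<lambda>_. undefined)) (?A (Suc n))"
    using A [of "Suc n"] by (subst IT.emeasure_CI [of _ "Suc n"]) (simp_all del: IT.C.simps)
  also have "\<dots> = (\<Prod>t<Suc n. emeasure (walk_kernel E i t y) {y t})"
    by (rule C)
  also have "\<dots> = of_bool (y 0 = i) * (\<Prod>t<n. ennreal (pmf (step E (y t)) (y (Suc t))))"
    by (subst prod.lessThan_Suc_shift)
      (auto simp: walk_kernel_def emeasure_pmf_single)
  finally show ?thesis .
qed

definition hitting_time :: "'n \<Rightarrow> (nat \<Rightarrow> 'n) \<Rightarrow> enat" where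
  "hitting_time j x = (INF t\<in>{t. x t = j}. enat t)"

definition mean_hitting :: "('n::finite \<Rightarrow> 'n \<Rightarrow> bool) \<Rightarrow> 'n \<Rightarrow> 'n \<Rightarrow> ennreal" where
  "mean_hitting E i j = (\<integral>\<^sup>+x. ennreal_of_enat (hitting_time j x) \<partial>walk E i)"


text \<open>Randomization of a stopping time is provided by a variable \<open>u\<close>, uniform on \<open>[0,1]\<close>, independent of
  the walk and known from time \<open>0\<close> on; the information at time \<open>t\<close> is that of \<open>u\<close> and
  \<open>(X\<^sub>s)\<^sub>s\<^sub>\<le>\<^sub>t\<close>. Times are extended naturals since a stopping time may be infinite on a null set.\<close>

definition rand_walk :: "('n::finite \<Rightarrow> 'n \<Rightarrow> bool) \<Rightarrow> 'n \<Rightarrow> ((nat \<Rightarrow> 'n) \<times> real) measure" where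
  "rand_walk E i = walk E i \<Otimes>\<^sub>M uniform_measure lborel {0..1}"

definition rand_filtration :: "enat \<Rightarrow> ((nat \<Rightarrow> 'n) \<times> real) measure" where
  "rand_filtration t = vimage_algebra UNIV (\<lambda>(x, u). (restrict x {s. enat s \<le> t}, u))
     (PiM {s. enat s \<le> t} (\<lambda>_. count_space UNIV) \<Otimes>\<^sub>M borel)"

text \<open>If \<open>p\<close> has total mass \<open>1\<close>, the last conjunct forces almost sure finiteness.\<close>

definition stopping_rule ::
  "('n::finite \<Rightarrow> 'n \<Rightarrow> bool) \<Rightarrow> 'n \<Rightarrow> real^'n \<Rightarrow> ((nat \<Rightarrow> 'n) \<times> real \<Rightarrow> enat) \<Rightarrow> bool" where
  "stopping_rule E i p T \<longleftrightarrow> stopping_time rand_filtration T \<and>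
     (\<forall>j. measure (rand_walk E i) {(x, u). \<exists>t. T (x, u) = enat t \<and> x t = j} = p $ j)"

definition H_pi :: "('n::finite \<Rightarrow> 'n \<Rightarrow> bool) \<Rightarrow> 'n \<Rightarrow> ennreal" where
  "H_pi E i = (LEAST h. \<exists>T. stopping_rule E i (stationary E) T \<and>
     h = (\<integral>\<^sup>+\<omega>. ennreal_of_enat (T \<omega>) \<partial>rand_walk E i))"

definition T_mix :: "('n::finite \<Rightarrow> 'n \<Rightarrow> bool) \<Rightarrow> ennreal" where
  "T_mix E = Max (range (H_pi E))"

definition T_reset :: "('n::finite \<Rightarrow> 'n \<Rightarrow> bool) \<Rightarrow> ennreal" where
  "T_reset E = (\<Sum>i\<in>UNIV. ennreal (stationary E $ i) * H_pi E i)"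

definition T_hit :: "('n::finite \<Rightarrow> 'n \<Rightarrow> bool) \<Rightarrow> ennreal" where
  "T_hit E = (\<Sum>i\<in>UNIV. \<Sum>k\<in>UNIV. ennreal (stationary E $ i * stationary E $ k) * mean_hitting E i k)"

end

theory Submission
  imports Defs
begin

text \<open>
  In terms of the solution \<open>G\<close> of \<open>(I - P) G = I - 1 \<pi>\<^sup>T\<close>, \<open>\<pi>\<^sup>T G = 0\<close>, obtained from the eigenvectors,
  optional stopping turns the law \<open>p\<close> of the stopped walk into
  \<open>\<Sum>\<^sub>v p v * G v k - G i k = \<pi> k * (expected length) - (expected number of departures from k)\<close>.
  Hitting \<open>j\<close> never departs from \<open>j\<close>, which gives \<open>H(i,j)\<close>. For \<open>p = \<pi>\<close> the expected length is at
  least \<open>- G i k / \<pi> k\<close> for every \<open>k\<close>, with equality if the rule never departs from \<open>k\<close>; the filling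
  rule stops as much mass as possible at every moment and therefore has such a vertex \<open>k\<close>.
\<close>

section \<open>Spectral solution of the Green's function equations\<close>

text \<open>A stopping rule is a measurable map on trajectories, but its law and its expected length
  depend only on the masses that pass and stop at each vertex and time. These masses obey a linear
  recursion, so optional stopping becomes a finite telescoping sum followed by limits of real
  series. The hitting time, an arbitrary rule and the filling rule then share the same two facts:
  the identity of the overview, and the criterion that a vertex without departures forces finite
  expected length. The filling rule is first built as a flow; a single uniform variable afterwards
  realizes it as a stopping time with the same masses.

  The farthest vertex enters through reversibility:
  \<open>- G i k / \<pi> k = - G k i / \<pi> i\<close>, which differs from the mean hitting time of
  \<open>i\<close> from \<open>k\<close> only by \<open>G i i / \<pi> i\<close>, a term independent
  of \<open>k\<close>. Hence the best lower bound for rules started at \<open>i\<close> is found at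
  the vertex from which \<open>i\<close> is hardest to hit.\<close>

lemma diag_mult_nth: "(diag d ** A) $ i $ j = d i * A $ i $ j"
  unfolding diag_def matrix_matrix_mult_def
  by (simp add: if_distrib [where f = "\<lambda>x. x * _"] sum.delta cong: if_cong)

lemma mult_diag_nth: "(A ** diag d) $ i $ j = A $ i $ j * d j"
  unfolding diag_def matrix_matrix_mult_def
  by (simp add: if_distrib [where f = "\<lambda>x. _ * x"] sum.delta cong: if_cong)

lemma transition_nth: "transition E $ v $ w = (if E v w then 1 / real (deg E v) else 0)"
  by (simp add: transition_def diag_mult_nth adjacency_def)

lemma normalized_laplacian_nth:
  "normalized_laplacian E $ i $ j =
    of_bool (i = j) - (if E i j then 1 / (sqrt (deg E i) * sqrt (deg E j)) else 0)"
  by (simp add: normalized_laplacian_def diag_mult_nth mult_diag_nth adjacency_def mat_def)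

lemma matrix_diff_ldistrib:
  fixes A :: "'a::comm_ring_1^'n^'m"
  shows "A ** (B - C) = A ** B - A ** C"
  by (simp add: vec_eq_iff matrix_matrix_mult_def right_diff_distrib sum_subtractf)

lemma matrix_diff_rdistrib:
  fixes A B :: "'a::comm_ring_1^'n^'m"
  shows "(A - B) ** C = A ** C - B ** C"
  by (simp add: vec_eq_iff matrix_matrix_mult_def left_diff_distrib sum_subtractf)

text \<open>A square matrix with orthonormal rows also has orthonormal columns. The bijection
  \<open>h\<close> only moves the index set of the family onto \<open>'n\<close>, so that the
  vectors can be the rows of a square matrix.\<close>

lemma orthonormal_family_completeness:
  fixes \<phi> :: "nat \<Rightarrow> real^'n"
  assumes "\<And>k l. k < CARD('n) \<Longrightarrow> l < CARD('n) \<Longrightarrow> \<phi> k \<bullet> \<phi> l = of_bool (k = l)"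
  shows "(\<Sum>k<CARD('n). \<phi> k $ i * \<phi> k $ j) = of_bool (i = j)"
proof -
  obtain h where h: "bij_betw h (UNIV :: 'n set) {..<CARD('n)}"
    using finite_same_card_bij[of "UNIV :: 'n set" "{..<CARD('n)}"] by auto
  define Q :: "real^'n^'n" where "Q = (\<chi> i. \<phi> (h i))"
  have h_less: "h k < CARD('n)" for k
    using h by (auto simp: bij_betw_def)
  have h_inj: "h k = h l \<longleftrightarrow> k = l" for k l
    using h by (auto simp: bij_betw_def inj_eq)
  have "Q ** transpose Q = mat 1"
    using assms[OF h_less h_less]
    by (simp add: vec_eq_iff Q_def matrix_matrix_mult_def transpose_def mat_def inner_vec_def h_inj)
  then have "transpose Q ** Q = mat 1"
    by (simp add: matrix_left_right_inverse)
  then have "(transpose Q ** Q) $ i $ j = of_bool (i = j)"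
    by (simp add: mat_def)
  then have "(\<Sum>k\<in>UNIV. \<phi> (h k) $ i * \<phi> (h k) $ j) = of_bool (i = j)"
    by (simp add: Q_def matrix_matrix_mult_def transpose_def)
  then show ?thesis
    using sum.reindex_bij_betw[OF h, of "\<lambda>k. \<phi> k $ i * \<phi> k $ j"] by simp
qed

text \<open>Irreducibility of the walk is used in the spectral form \<open>lam_pos\<close>: the
  eigenvalue 0 is simple, so the Laplacian can be inverted on the orthogonal complement of
  \<open>\<phi> 0\<close>.\<close>

locale graph_spectrum =
  fixes E :: "'n::finite \<Rightarrow> 'n \<Rightarrow> bool" and lam :: "nat \<Rightarrow> real" and \<phi> :: "nat \<Rightarrow> real^'n"
  assumes edge_sym: "E u v \<Longrightarrow> E v u"
    and deg_pos: "0 < deg E v"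
    and lam_pos: "\<And>k. 1 \<le> k \<Longrightarrow> k < CARD('n) \<Longrightarrow> 0 < lam k"
    and eigen: "\<And>k. k < CARD('n) \<Longrightarrow> normalized_laplacian E *v \<phi> k = lam k *\<^sub>R \<phi> k"
    and orthonormal: "\<And>k l. k < CARD('n) \<Longrightarrow> l < CARD('n) \<Longrightarrow> \<phi> k \<bullet> \<phi> l = of_bool (k = l)"
begin

abbreviation P :: "'n \<Rightarrow> 'n \<Rightarrow> real" where "P u v \<equiv> transition E $ u $ v"
abbreviation \<pi> :: "'n \<Rightarrow> real" where "\<pi> v \<equiv> stationary E $ v"

lemma vol_pos: "0 < vol E"
  unfolding vol_def using deg_pos by (intro sum_pos) auto

lemma \<pi>_pos: "0 < \<pi> v"
  using deg_pos[of v] vol_pos by (simp add: stationary_def)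

lemma sum_\<pi>: "(\<Sum>v\<in>UNIV. \<pi> v) = 1"
proof -
  have "(\<Sum>v\<in>UNIV. \<pi> v) = real (vol E) / real (vol E)"
    unfolding vol_def by (simp add: stationary_def vol_def flip: sum_divide_distrib)
  then show ?thesis using vol_pos by simp
qed

lemma P_nonneg: "0 \<le> P u v"
  by (simp add: transition_nth)

lemma sum_P: "(\<Sum>v\<in>UNIV. P u v) = 1"
  using deg_pos[of u] card_gt_0_iff[of "{v. E u v}"]
  by (simp add: transition_nth deg_def flip: sum.inter_filter)

section \<open>The null vector of the Laplacian and the eigenbasis\<close>

lemma laplacian_sqrt_deg: "(\<Sum>j\<in>UNIV. normalized_laplacian E $ i $ j * sqrt (deg E j)) = 0"
proof -
  have "(\<Sum>j\<in>UNIV. normalized_laplacian E $ i $ j * sqrt (deg E j))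
      = (\<Sum>j\<in>UNIV. of_bool (i = j) * sqrt (deg E j)) - (\<Sum>j\<in>UNIV. if E i j then 1 / sqrt (deg E i) else 0)"
    unfolding sum_subtractf[symmetric] normalized_laplacian_nth
    using deg_pos by (intro sum.cong) (auto simp: field_simps)
  also have "\<dots> = sqrt (deg E i) - deg E i / sqrt (deg E i)"
    by (simp add: deg_def flip: sum.inter_filter)
  also have "\<dots> = 0"
    by (simp add: real_div_sqrt)
  finally show ?thesis .
qed

lemma laplacian_sym: "normalized_laplacian E $ i $ j = normalized_laplacian E $ j $ i"
  using edge_sym by (auto simp: normalized_laplacian_nth)

lemma laplacian_\<phi>:
  "k < CARD('n) \<Longrightarrow> (\<Sum>l\<in>UNIV. normalized_laplacian E $ i $ l * \<phi> k $ l) = lam k * \<phi> k $ i"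
  using arg_cong[OF eigen, of k "\<lambda>x. x $ i"] by (simp add: matrix_vector_mult_def)

text \<open>Symmetry moves the Laplacian from \<open>\<phi> k\<close> onto its null vector, so
  \<open>lam k\<close> times the sum vanishes.\<close>

lemma \<phi>_orthogonal_sqrt_deg:
  assumes "1 \<le> k" "k < CARD('n)"
  shows "(\<Sum>i\<in>UNIV. sqrt (deg E i) * \<phi> k $ i) = 0"
proof -
  have "lam k * (\<Sum>i\<in>UNIV. sqrt (deg E i) * \<phi> k $ i)
      = (\<Sum>i\<in>UNIV. sqrt (deg E i) * (\<Sum>l\<in>UNIV. normalized_laplacian E $ i $ l * \<phi> k $ l))"
    unfolding laplacian_\<phi>[OF assms(2)] by (simp add: sum_distrib_left mult_ac)
  also have "\<dots> = (\<Sum>l\<in>UNIV. \<Sum>i\<in>UNIV. sqrt (deg E i) * (normalized_laplacian E $ i $ l * \<phi> k $ l))"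
    unfolding sum_distrib_left by (rule sum.swap)
  also have "\<dots> = (\<Sum>l\<in>UNIV. \<phi> k $ l * (\<Sum>i\<in>UNIV. normalized_laplacian E $ l $ i * sqrt (deg E i)))"
    unfolding sum_distrib_left
    by (subst laplacian_sym) (simp only: mult_ac)
  also have "\<dots> = 0"
    by (simp add: laplacian_sqrt_deg)
  finally show ?thesis
    using lam_pos[OF assms] by simp
qed

text \<open>A product, because \<open>\<phi> 0\<close> is determined only up to sign. In the
  expansion of the vector \<open>sqrt (deg E i)\<close> only the coefficient \<open>c\<close> of
  \<open>\<phi> 0\<close> survives, and comparing squared norms gives
  \<open>c\<^sup>2 = vol E\<close>.\<close>

lemma \<phi>_0_mult: "\<phi> 0 $ i * \<phi> 0 $ j = sqrt (deg E i) * sqrt (deg E j) / vol E"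
proof -
  define c where "c = (\<Sum>i\<in>UNIV. sqrt (deg E i) * \<phi> 0 $ i)"
  have expand: "sqrt (deg E i) = c * \<phi> 0 $ i" for i
  proof -
    have "sqrt (deg E i) = (\<Sum>j\<in>UNIV. sqrt (deg E j) * of_bool (j = i))"
      by simp
    also have "\<dots> = (\<Sum>j\<in>UNIV. \<Sum>k<CARD('n). sqrt (deg E j) * (\<phi> k $ j * \<phi> k $ i))"
      by (simp add: orthonormal_family_completeness[OF orthonormal] flip: sum_distrib_left)
    also have "\<dots> = (\<Sum>k<CARD('n). (\<Sum>j\<in>UNIV. sqrt (deg E j) * \<phi> k $ j) * \<phi> k $ i)"
      by (subst sum.swap) (simp add: sum_distrib_right mult.assoc)
    also have "\<dots> = (\<Sum>k\<in>{0}. (\<Sum>j\<in>UNIV. sqrt (deg E j) * \<phi> k $ j) * \<phi> k $ i)"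
      using \<phi>_orthogonal_sqrt_deg by (intro sum.mono_neutral_right) auto
    finally show ?thesis by (simp add: c_def)
  qed
  have "real (vol E) = (\<Sum>i\<in>UNIV. sqrt (deg E i) * sqrt (deg E i))"
    by (simp add: vol_def)
  also have "\<dots> = c\<^sup>2 * (\<phi> 0 \<bullet> \<phi> 0)"
    unfolding expand inner_vec_def by (simp add: sum_distrib_left power2_eq_square mult_ac)
  finally have "real (vol E) = c\<^sup>2"
    by (simp add: orthonormal)
  moreover from this have "c \<noteq> 0"
    using vol_pos by auto
  ultimately show ?thesis
    by (simp add: expand power2_eq_square)
qed

text \<open>The pseudoinverse of the normalized Laplacian: the term \<open>k = 0\<close>, belonging
  to the null vector, is left out.\<close>

definition green_sum :: "'n \<Rightarrow> 'n \<Rightarrow> real" where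
  "green_sum i j = (\<Sum>k = 1..CARD('n) - 1. 1 / lam k * \<phi> k $ i * \<phi> k $ j)"

lemma green_sum_commute: "green_sum i j = green_sum j i"
  by (simp add: green_sum_def mult_ac)

text \<open>Each factor \<open>lam k\<close> cancels, and what remains is the completeness relation
  without its term \<open>k = 0\<close>, that is, the projection away from the null vector.\<close>

lemma laplacian_green_sum:
  "(\<Sum>l\<in>UNIV. normalized_laplacian E $ i $ l * green_sum l j) =
    of_bool (i = j) - sqrt (deg E i) * sqrt (deg E j) / vol E"
proof -
  have "(\<Sum>l\<in>UNIV. normalized_laplacian E $ i $ l * green_sum l j)
      = (\<Sum>k = 1..CARD('n) - 1. 1 / lam k * \<phi> k $ j *
          (\<Sum>l\<in>UNIV. normalized_laplacian E $ i $ l * \<phi> k $ l))"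
    unfolding green_sum_def sum_distrib_left
    by (subst sum.swap) (simp add: mult_ac)
  also have "\<dots> = (\<Sum>k = 1..CARD('n) - 1. \<phi> k $ i * \<phi> k $ j)"
  proof (intro sum.cong refl)
    fix k assume "k \<in> {1..CARD('n) - 1}"
    then have k: "1 \<le> k" "k < CARD('n)" by auto
    show "1 / lam k * \<phi> k $ j * (\<Sum>l\<in>UNIV. normalized_laplacian E $ i $ l * \<phi> k $ l) = \<phi> k $ i * \<phi> k $ j"
      using lam_pos[OF k] by (simp add: laplacian_\<phi> k)
  qed
  also have "\<dots> = (\<Sum>k<CARD('n). \<phi> k $ i * \<phi> k $ j) - \<phi> 0 $ i * \<phi> 0 $ j"
  proof -
    have "{..<CARD('n)} = insert 0 {1..CARD('n) - 1}"
      by auto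
    then show ?thesis by simp
  qed
  finally show ?thesis
    by (simp add: orthonormal_family_completeness[OF orthonormal] \<phi>_0_mult)
qed

lemma green_sum_sqrt_deg: "(\<Sum>j\<in>UNIV. green_sum i j * sqrt (deg E j)) = 0"
proof -
  have "(\<Sum>j\<in>UNIV. green_sum i j * sqrt (deg E j))
      = (\<Sum>k = 1..CARD('n) - 1. 1 / lam k * \<phi> k $ i * (\<Sum>j\<in>UNIV. sqrt (deg E j) * \<phi> k $ j))"
    unfolding green_sum_def sum_distrib_left sum_distrib_right
    by (subst sum.swap) (simp add: mult_ac)
  also have "\<dots> = 0"
    using \<phi>_orthogonal_sqrt_deg by (intro sum.neutral) auto
  finally show ?thesis .
qed

text \<open>The matrix \<open>I - P\<close> equals D^(-1/2) L D^(1/2) with L the normalized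
  Laplacian, so the pseudoinverse of L is conjugated in the same way.\<close>

definition G :: "'n \<Rightarrow> 'n \<Rightarrow> real" where
  "G i j = sqrt (deg E j) / sqrt (deg E i) * green_sum i j"

lemma G_reversible: "G i j / \<pi> j = G j i / \<pi> i"
proof -
  have "G i j / \<pi> j = vol E * (green_sum i j / (sqrt (deg E i) * sqrt (deg E j)))" for i j
    using deg_pos[of j] by (simp add: G_def stationary_def divide_simps mult_ac)
  then show ?thesis
    by (simp only: green_sum_commute[of i j] mult.commute[of "sqrt (deg E i)"])
qed

lemma one_minus_P: "of_bool (i = l) - P i l =
    normalized_laplacian E $ i $ l * (sqrt (deg E l) / sqrt (deg E i))"
proof -
  have "1 / real (deg E i) = 1 / (sqrt (deg E i) * sqrt (deg E l)) * (sqrt (deg E l) / sqrt (deg E i))"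
    using deg_pos[of i] deg_pos[of l] by simp
  moreover have "sqrt (deg E i) \<noteq> 0" "sqrt (deg E l) \<noteq> 0"
    using deg_pos[of i] deg_pos[of l] by auto
  ultimately show ?thesis
    by (auto simp: normalized_laplacian_nth transition_nth algebra_simps)
qed

lemma one_minus_P_G: "(\<Sum>l\<in>UNIV. (of_bool (i = l) - P i l) * G l j) = of_bool (i = j) - \<pi> j"
proof -
  have s: "deg E v \<noteq> 0" for v
    using deg_pos[of v] by auto
  have "(\<Sum>l\<in>UNIV. (of_bool (i = l) - P i l) * G l j)
      = sqrt (deg E j) / sqrt (deg E i) * (\<Sum>l\<in>UNIV. normalized_laplacian E $ i $ l * green_sum l j)"
    unfolding one_minus_P G_def sum_distrib_left by (intro sum.cong refl) (simp add: s)
  also have "\<dots> = of_bool (i = j) - \<pi> j"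
    unfolding laplacian_green_sum using s[of i]
    by (auto simp: stationary_def algebra_simps) 
  finally show ?thesis .
qed

text \<open>Both \<open>G\<close> and \<open>I - P\<close> are self-adjoint for the inner product
  weighted by \<open>\<pi>\<close>. Transposing with respect to it turns the right-inverse identity
  \<open>one_minus_P_G\<close> into this left-inverse identity.\<close>

lemma G_one_minus_P: "(\<Sum>l\<in>UNIV. G i l * (of_bool (l = j) - P l j)) = of_bool (i = j) - \<pi> j"
proof -
  have P: "\<pi> l * (of_bool (l = j) - P l j) = \<pi> j * (of_bool (j = l) - P j l)" for l
    using deg_pos[of l] deg_pos[of j] edge_sym[of l j] edge_sym[of j l]
    by (auto simp: transition_nth stationary_def)
  have G: "G i l = G l i / \<pi> i * \<pi> l" for l
    using G_reversible[of i l] \<pi>_pos[of l] by (simp add: field_simps)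
  have "(\<Sum>l\<in>UNIV. G i l * (of_bool (l = j) - P l j))
      = (\<Sum>l\<in>UNIV. G l i / \<pi> i * (\<pi> l * (of_bool (l = j) - P l j)))"
    by (subst G) (simp only: mult.assoc)
  also have "\<dots> = \<pi> j / \<pi> i * (\<Sum>l\<in>UNIV. (of_bool (j = l) - P j l) * G l i)"
    unfolding P sum_distrib_left by (intro sum.cong) auto
  also have "\<dots> = of_bool (i = j) - \<pi> j"
    unfolding one_minus_P_G using \<pi>_pos[of i] by (auto simp: field_simps)
  finally show ?thesis .
qed

lemma sum_G: "(\<Sum>j\<in>UNIV. G i j) = 0"
proof -
  have "(\<Sum>j\<in>UNIV. G i j) = (\<Sum>j\<in>UNIV. green_sum i j * sqrt (deg E j)) / sqrt (deg E i)"
    by (simp add: G_def sum_divide_distrib mult_ac)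
  then show ?thesis by (simp add: green_sum_sqrt_deg)
qed

lemma sum_\<pi>_G: "(\<Sum>i\<in>UNIV. \<pi> i * G i j) = 0"
proof -
  have "\<pi> i * G i j = \<pi> j * G j i" for i
    using G_reversible[of i j] \<pi>_pos[of i] \<pi>_pos[of j] by (simp add: field_simps)
  then show ?thesis
    by (simp add: sum_G flip: sum_distrib_left)
qed

text \<open>Uniqueness comes from evaluating \<open>H (I - P) G\<close> in two ways: it is
  \<open>H\<close> because \<open>H\<close> annihilates constants, and it is \<open>G\<close>
  because \<open>\<pi>\<close> annihilates \<open>G\<close> from the left.\<close>

lemma green_eq: "green E = (\<chi> i j. G i j)"
  unfolding green_def
proof (rule the_equality)
  let ?G = "\<chi> i j. G i j" and ?\<Pi> = "\<chi> i j. stationary E $ j"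
  show "?G ** (mat 1 - transition E) = mat 1 - ?\<Pi> \<and> ?G *v 1 = 0"
    using G_one_minus_P sum_G
    by (simp add: vec_eq_iff matrix_matrix_mult_def matrix_vector_mult_def mat_def of_bool_def)
  have right: "(mat 1 - transition E) ** ?G = mat 1 - ?\<Pi>"
    using one_minus_P_G
    by (simp add: vec_eq_iff matrix_matrix_mult_def mat_def of_bool_def)
  fix H assume H: "H ** (mat 1 - transition E) = mat 1 - ?\<Pi> \<and> H *v 1 = 0"
  have "H ** ?\<Pi> = 0"
    using H by (simp add: vec_eq_iff matrix_matrix_mult_def matrix_vector_mult_def flip: sum_distrib_right)
  moreover have "?\<Pi> ** ?G = 0"
    using sum_\<pi>_G by (simp add: vec_eq_iff matrix_matrix_mult_def)
  moreover have "H ** ((mat 1 - transition E) ** ?G) = (mat 1 - ?\<Pi>) ** ?G"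
    using H by (simp add: matrix_mul_assoc)
  ultimately show "H = ?G"
    unfolding right by (simp add: matrix_diff_ldistrib matrix_diff_rdistrib)
qed

lemma trace_G: "(\<Sum>i\<in>UNIV. G i i) = (\<Sum>k = 1..CARD('n) - 1. 1 / lam k)"
proof -
  have "G i i = green_sum i i" for i
    using deg_pos[of i] by (simp add: G_def)
  then have "(\<Sum>i\<in>UNIV. G i i) = (\<Sum>k = 1..CARD('n) - 1. 1 / lam k * (\<phi> k \<bullet> \<phi> k))"
    unfolding green_sum_def inner_vec_def sum_distrib_left
    by (subst sum.swap) (simp add: mult_ac)
  also have "\<dots> = (\<Sum>k = 1..CARD('n) - 1. 1 / lam k)"
    by (intro sum.cong) (auto simp: orthonormal)
  finally show ?thesis .
qed

section \<open>Mass flows and the filling rule\<close>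

text \<open>\<open>a t v\<close> is the mass that leaves \<open>v\<close> at time \<open>t\<close> and \<open>b t v\<close> the mass that stops there.\<close>

definition flow :: "'n \<Rightarrow> (nat \<Rightarrow> 'n \<Rightarrow> real) \<Rightarrow> (nat \<Rightarrow> 'n \<Rightarrow> real) \<Rightarrow> bool" where
  "flow i a b \<longleftrightarrow> (\<forall>t v. 0 \<le> a t v) \<and> (\<forall>t v. 0 \<le> b t v) \<and>
    (\<forall>v. a 0 v + b 0 v = of_bool (v = i)) \<and>
    (\<forall>t v. a (Suc t) v + b (Suc t) v = (\<Sum>u\<in>UNIV. a t u * P u v))"

lemma flow_nonneg:
  assumes "flow i a b"
  shows "0 \<le> a t v" "0 \<le> b t v"
  using assms by (auto simp: flow_def)

text \<open>A discrete Dynkin formula for the test function \<open>g\<close>. The finite horizon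
  \<open>N\<close> postpones all questions of convergence; the last sum is the contribution of the
  mass that arrives at time \<open>N\<close>.\<close>

lemma flow_telescope:
  assumes "flow i a b"
  shows "(\<Sum>t<N. \<Sum>v\<in>UNIV. a t v * (g v - (\<Sum>w\<in>UNIV. P v w * g w))) =
    g i - (\<Sum>t<N. \<Sum>v\<in>UNIV. b t v * g v) - (\<Sum>v\<in>UNIV. (a N v + b N v) * g v)"
proof (induction N)
  case 0
  then show ?case using assms by (simp add: flow_def)
next
  case (Suc N)
  have "(\<Sum>v\<in>UNIV. (a (Suc N) v + b (Suc N) v) * g v) = (\<Sum>v\<in>UNIV. (\<Sum>u\<in>UNIV. a N u * P u v) * g v)"
    using assms by (simp add: flow_def)
  also have "\<dots> = (\<Sum>u\<in>UNIV. a N u * (\<Sum>v\<in>UNIV. P u v * g v))"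
    unfolding sum_distrib_left sum_distrib_right by (subst sum.swap) (simp add: mult_ac)
  finally show ?case
    using Suc by (simp add: algebra_simps sum.distrib sum_subtractf)
qed

text \<open>Conservation of mass: constants are harmonic, so the left side of
  \<open>flow_telescope\<close> vanishes.\<close>

lemma flow_mass:
  assumes "flow i a b"
  shows "(\<Sum>t<N. \<Sum>v\<in>UNIV. b t v) + (\<Sum>v\<in>UNIV. a N v + b N v) = 1"
  using flow_telescope[OF assms, where g = "\<lambda>_. 1" and N = N] by (simp add: sum_P)

lemma flow_summable_stop:
  assumes "flow i a b"
  shows "summable (\<lambda>t. b t v)"
proof (rule summableI_nonneg_bounded)
  show "0 \<le> b t v" for t using flow_nonneg[OF assms] by simp
  show "(\<Sum>t<N. b t v) \<le> 1" for N
  proof -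
    have "(\<Sum>t<N. b t v) \<le> (\<Sum>t<N. \<Sum>v\<in>UNIV. b t v)"
      using flow_nonneg[OF assms] by (intro sum_mono member_le_sum) auto
    also have "\<dots> \<le> 1"
      using flow_mass[OF assms, of N] sum_nonneg[of UNIV "\<lambda>v. a N v + b N v"] flow_nonneg[OF assms]
      by (smt (verit))
    finally show ?thesis .
  qed
qed

lemma G_minus_P_G: "G v k - (\<Sum>w\<in>UNIV. P v w * G w k) = of_bool (v = k) - \<pi> k"
  using one_minus_P_G[of v k] by (simp add: left_diff_distrib sum_subtractf)

text \<open>The potential \<open>w \<mapsto> (C - G w v) / \<pi> v\<close> decreases by exactly \<open>1\<close> per step
  as long as the flow does not leave \<open>v\<close>.\<close>

lemma flow_summable_halting:
  assumes "flow i a b" and halt: "\<And>t. a t v = 0"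
  shows "summable (\<lambda>t. \<Sum>w\<in>UNIV. a t w)"
proof -
  define C where "C = Max (range (\<lambda>w. G w v))"
  define g where "g w = (C - G w v) / \<pi> v" for w
  have g: "0 \<le> g w" for w
    using \<pi>_pos[of v] by (simp add: g_def C_def)
  have diff: "g w - (\<Sum>u\<in>UNIV. P w u * g u) = 1 - of_bool (w = v) / \<pi> v" for w
  proof -
    have "(\<Sum>u\<in>UNIV. P w u * g u) = ((\<Sum>u\<in>UNIV. P w u) * C - (\<Sum>u\<in>UNIV. P w u * G u v)) / \<pi> v"
      unfolding g_def sum_distrib_right sum_subtractf[symmetric] sum_divide_distrib
      by (simp add: right_diff_distrib)
    then have "g w - (\<Sum>u\<in>UNIV. P w u * g u) = - (G w v - (\<Sum>u\<in>UNIV. P w u * G u v)) / \<pi> v"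
      by (simp add: sum_P g_def diff_divide_distrib)
    then show ?thesis
      unfolding G_minus_P_G using \<pi>_pos[of v] by (simp add: field_simps)
  qed
  show ?thesis
  proof (rule summableI_nonneg_bounded)
    show "0 \<le> (\<Sum>w\<in>UNIV. a t w)" for t
      using flow_nonneg[OF assms(1)] by (simp add: sum_nonneg)
    show "(\<Sum>t<N. \<Sum>w\<in>UNIV. a t w) \<le> g i" for N
    proof -
      have "(\<Sum>t<N. \<Sum>w\<in>UNIV. a t w) =
          (\<Sum>t<N. \<Sum>w\<in>UNIV. a t w * (g w - (\<Sum>u\<in>UNIV. P w u * g u)))"
        unfolding diff using halt by (intro sum.cong refl) (auto simp: of_bool_def)
      also have "\<dots> = g i - (\<Sum>t<N. \<Sum>v\<in>UNIV. b t v * g v) - (\<Sum>v\<in>UNIV. (a N v + b N v) * g v)"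
        by (rule flow_telescope[OF assms(1)])
      also have "\<dots> \<le> g i"
      proof -
        have "0 \<le> (\<Sum>t<N. \<Sum>v\<in>UNIV. b t v * g v)" "0 \<le> (\<Sum>v\<in>UNIV. (a N v + b N v) * g v)"
          using flow_nonneg[OF assms(1)] g
          by (auto intro!: sum_nonneg mult_nonneg_nonneg add_nonneg_nonneg)
        then show ?thesis by simp
      qed
      finally show ?thesis .
    qed
  qed
qed

lemma flow_summable_go:
  assumes "flow i a b" "summable (\<lambda>t. \<Sum>w\<in>UNIV. a t w)"
  shows "summable (\<lambda>t. a t v)"
proof (rule summable_comparison_test'[OF assms(2), of 0])
  show "norm (a t v) \<le> (\<Sum>w\<in>UNIV. a t w)" for t
    using flow_nonneg[OF assms(1)] member_le_sum[of v UNIV "a t"] by simp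
qed

text \<open>Finite expected length forces the mass still moving at time \<open>N\<close> to tend to
  0, so no mass is lost in the limit of \<open>flow_mass\<close>.\<close>

lemma flow_total_stop:
  assumes "flow i a b" "summable (\<lambda>t. \<Sum>w\<in>UNIV. a t w)"
  shows "(\<Sum>v\<in>UNIV. \<Sum>t. b t v) = 1"
proof -
  have "(\<lambda>N. \<Sum>v\<in>UNIV. \<Sum>t<N. b t v) \<longlonglongrightarrow> (\<Sum>v\<in>UNIV. \<Sum>t. b t v)"
    by (intro tendsto_sum summable_LIMSEQ flow_summable_stop[OF assms(1)])
  moreover have "(\<lambda>N. \<Sum>v\<in>UNIV. a N v + b N v) \<longlonglongrightarrow> (\<Sum>v\<in>(UNIV :: 'n set). 0 + 0)"
    by (intro tendsto_sum tendsto_add summable_LIMSEQ_zero flow_summable_stop[OF assms(1)]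
        flow_summable_go[OF assms])
  ultimately have "(\<lambda>N. (\<Sum>v\<in>UNIV. \<Sum>t<N. b t v) + (\<Sum>v\<in>UNIV. a N v + b N v)) \<longlonglongrightarrow>
      (\<Sum>v\<in>UNIV. \<Sum>t. b t v) + (\<Sum>v\<in>(UNIV :: 'n set). 0 + 0)"
    by (rule tendsto_add)
  moreover have "(\<Sum>v\<in>UNIV. \<Sum>t<N. b t v) + (\<Sum>v\<in>UNIV. a N v + b N v) = 1" for N
    by (subst sum.swap) (rule flow_mass[OF assms(1)])
  ultimately show ?thesis
    by (simp add: LIMSEQ_const_iff)
qed

text \<open>The limit of \<open>flow_telescope\<close> with column \<open>k\<close> of
  \<open>G\<close> as test function, whose drift is \<open>of_bool (v = k) - \<pi> k\<close>. The
  remainder vanishes because the masses at each vertex are summable in time and there are finitely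
  many vertices.\<close>

lemma flow_green_identity:
  assumes "flow i a b" "summable (\<lambda>t. \<Sum>w\<in>UNIV. a t w)" "\<And>v. (\<lambda>t. b t v) sums p v"
  shows "(\<Sum>v\<in>UNIV. p v * G v k) - G i k = \<pi> k * (\<Sum>t. \<Sum>w\<in>UNIV. a t w) - (\<Sum>t. a t k)"
proof -
  have a: "summable (\<lambda>t. a t v)" for v
    by (rule flow_summable_go[OF assms(1,2)])
  have lim1: "(\<lambda>N. (\<Sum>t<N. a t k) - \<pi> k * (\<Sum>t<N. \<Sum>w\<in>UNIV. a t w)) \<longlonglongrightarrow>
      (\<Sum>t. a t k) - \<pi> k * (\<Sum>t. \<Sum>w\<in>UNIV. a t w)"
    by (intro tendsto_intros summable_LIMSEQ a assms(2))
  have lim2: "(\<lambda>N. G i k - (\<Sum>v\<in>UNIV. (\<Sum>t<N. b t v) * G v k) - (\<Sum>v\<in>UNIV. (a N v + b N v) * G v k))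
      \<longlonglongrightarrow> G i k - (\<Sum>v\<in>UNIV. p v * G v k) - (\<Sum>v\<in>(UNIV :: 'n set). (0 + 0) * G v k)"
    using assms(3) unfolding sums_def
    by (intro tendsto_intros summable_LIMSEQ_zero a flow_summable_stop[OF assms(1)])
  have eq: "(\<Sum>t<N. a t k) - \<pi> k * (\<Sum>t<N. \<Sum>w\<in>UNIV. a t w) =
      G i k - (\<Sum>v\<in>UNIV. (\<Sum>t<N. b t v) * G v k) - (\<Sum>v\<in>UNIV. (a N v + b N v) * G v k)" for N
  proof -
    have "(\<Sum>t<N. a t k) - \<pi> k * (\<Sum>t<N. \<Sum>w\<in>UNIV. a t w) =
        (\<Sum>t<N. \<Sum>v\<in>UNIV. a t v * (G v k - (\<Sum>w\<in>UNIV. P v w * G w k)))"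
      unfolding G_minus_P_G
      by (simp add: right_diff_distrib sum_subtractf mult.commute[of "\<pi> k"] flip: sum_distrib_right)
    also have "\<dots> = G i k - (\<Sum>t<N. \<Sum>v\<in>UNIV. b t v * G v k) - (\<Sum>v\<in>UNIV. (a N v + b N v) * G v k)"
      by (rule flow_telescope[OF assms(1)])
    also have "(\<Sum>t<N. \<Sum>v\<in>UNIV. b t v * G v k) = (\<Sum>v\<in>UNIV. (\<Sum>t<N. b t v) * G v k)"
      by (subst sum.swap) (simp add: sum_distrib_right)
    finally show ?thesis .
  qed
  show ?thesis
    using LIMSEQ_unique[OF lim1[unfolded eq] lim2] by simp
qed

lemma flow_stationary_lower_bound:
  assumes "flow i a b" "summable (\<lambda>t. \<Sum>w\<in>UNIV. a t w)" "\<And>v. (\<lambda>t. b t v) sums \<pi> v"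
  shows "- G i k / \<pi> k \<le> (\<Sum>t. \<Sum>w\<in>UNIV. a t w)"
proof -
  have "0 \<le> (\<Sum>t. a t k)"
    by (intro suminf_nonneg flow_summable_go[OF assms(1,2)] flow_nonneg[OF assms(1)])
  then show ?thesis
    using flow_green_identity[OF assms, of k] \<pi>_pos[of k] by (simp add: sum_\<pi>_G field_simps)
qed

text \<open>The filling rule: mass arriving at \<open>v\<close> is stopped there until \<open>v\<close> holds mass \<open>\<pi> v\<close>. The two
  components are the mass stopped before time \<open>t\<close> and the mass arriving at time \<open>t\<close>.\<close>

primrec fill :: "'n \<Rightarrow> nat \<Rightarrow> ('n \<Rightarrow> real) \<times> ('n \<Rightarrow> real)" where
  "fill i 0 = (\<lambda>v. 0, \<lambda>v. of_bool (v = i))"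
| "fill i (Suc t) =
    (\<lambda>v. fst (fill i t) v + min (snd (fill i t) v) (\<pi> v - fst (fill i t) v),
     \<lambda>v. \<Sum>u\<in>UNIV. (snd (fill i t) u - min (snd (fill i t) u) (\<pi> u - fst (fill i t) u)) * P u v)"

definition fill_stop :: "'n \<Rightarrow> nat \<Rightarrow> 'n \<Rightarrow> real" where
  "fill_stop i t v = min (snd (fill i t) v) (\<pi> v - fst (fill i t) v)"

definition fill_go :: "'n \<Rightarrow> nat \<Rightarrow> 'n \<Rightarrow> real" where
  "fill_go i t v = snd (fill i t) v - fill_stop i t v"

lemma fst_fill: "fst (fill i t) v = (\<Sum>r<t. fill_stop i r v)"
  by (induction t) (auto simp: fill_stop_def)

lemma fill_bounds: "0 \<le> snd (fill i t) v \<and> fst (fill i t) v \<le> \<pi> v"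
proof (induction t arbitrary: v)
  case 0
  then show ?case using \<pi>_pos[of v] by (simp add: less_imp_le)
next
  case (Suc t)
  then show ?case by (auto intro!: sum_nonneg mult_nonneg_nonneg P_nonneg)
qed

lemma flow_fill: "flow i (fill_go i) (fill_stop i)"
  unfolding flow_def
proof (intro conjI allI)
  fix t v
  show "0 \<le> fill_go i t v"
    by (simp add: fill_go_def fill_stop_def)
  show "0 \<le> fill_stop i t v"
    using fill_bounds[of i t v] by (simp add: fill_stop_def)
  show "fill_go i 0 v + fill_stop i 0 v = of_bool (v = i)"
    by (simp add: fill_go_def)
  show "fill_go i (Suc t) v + fill_stop i (Suc t) v = (\<Sum>u\<in>UNIV. fill_go i t u * P u v)"
    by (simp add: fill_go_def) (simp add: fill_stop_def)
qed

text \<open>Mass leaves a vertex only when its remaining capacity is the smaller argument of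
  \<open>min\<close>; the vertex is then full, and the stopped mass can neither decrease nor exceed
  \<open>\<pi> v\<close>.\<close>

lemma fill_full:
  assumes "fill_go i t v \<noteq> 0" "t < r"
  shows "fst (fill i r) v = \<pi> v"
proof -
  have "fst (fill i (Suc t)) v = \<pi> v"
    using assms(1) by (auto simp: fill_go_def fill_stop_def min_def split: if_splits)
  moreover have "fst (fill i (Suc t)) v \<le> fst (fill i r) v"
    unfolding fst_fill using assms(2) flow_nonneg[OF flow_fill] by (intro sum_mono2) auto
  ultimately show ?thesis
    using fill_bounds[of i r v] by simp
qed

text \<open>The vertex that is filled last never lets any mass pass.\<close>

lemma fill_halting_state:
  obtains v where "\<And>t. fill_go i t v = 0"
proof -
  have "\<exists>v. \<forall>t. fill_go i t v = 0"
  proof (rule ccontr)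
    assume "\<not> ?thesis"
    then obtain s where s: "fill_go i (s v) v \<noteq> 0" for v
      by metis
    \<comment> \<open>If every vertex let mass pass, all of them would be full just after
      \<open>N\<close>. The total mass 1 would then be stopped by time \<open>N\<close> inclusive,
      leaving nothing to depart at time \<open>N\<close>, although \<open>u\<close> has a departure
      exactly then.\<close>
    define N where "N = Max (range s)"
    have N: "s v \<le> N" for v
      by (simp add: N_def)
    have "N \<in> range s"
      unfolding N_def by (rule Max_in) auto
    then obtain u where u: "N = s u" by auto
    have "(\<Sum>t<Suc N. \<Sum>v\<in>UNIV. fill_stop i t v) = (\<Sum>v\<in>UNIV. fst (fill i (Suc N)) v)"
      unfolding fst_fill by (rule sum.swap)
    also have "\<dots> = 1"
      using fill_full[OF s, of _ "Suc N"] N by (simp add: less_Suc_eq_le sum_\<pi> del: fill.simps)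
    finally have "(\<Sum>v\<in>UNIV. fill_go i N v) = 0"
      using flow_mass[OF flow_fill, of i N] by (simp add: sum.distrib)
    then have "fill_go i N u = 0"
      using flow_nonneg[OF flow_fill] by (simp add: sum_nonneg_eq_0_iff)
    then show False
      using s[of u] u by simp
  qed
  then show ?thesis using that by blast
qed

lemma fill_summable: "summable (\<lambda>t. \<Sum>w\<in>UNIV. fill_go i t w)"
proof -
  obtain v where "\<And>t. fill_go i t v = 0"
    by (rule fill_halting_state[of i]) blast
  then show ?thesis
    by (rule flow_summable_halting[OF flow_fill])
qed

text \<open>No vertex receives more than \<open>\<pi> v\<close>, and both sides have total mass 1,
  so there is equality at every vertex.\<close>

lemma fill_stop_sums: "(\<lambda>t. fill_stop i t v) sums \<pi> v"
proof -
  let ?b = "\<lambda>v. \<Sum>t. fill_stop i t v"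
  have le: "?b v \<le> \<pi> v" for v
    using fill_bounds[of i _ v] unfolding fst_fill
    by (intro suminf_le_const flow_summable_stop[OF flow_fill]) auto
  have "(\<Sum>v\<in>UNIV. \<pi> v - ?b v) = 0"
    by (simp add: sum_subtractf sum_\<pi> flow_total_stop[OF flow_fill fill_summable])
  then have "\<pi> v - ?b v = 0"
    using le by (simp add: sum_nonneg_eq_0_iff)
  then show ?thesis
    using summable_sums[OF flow_summable_stop[OF flow_fill], of i v] by simp
qed

definition mixing_cost :: "'n \<Rightarrow> real" where
  "mixing_cost i = Max (range (\<lambda>k. - G i k / \<pi> k))"

lemma fill_cost: "(\<Sum>t. \<Sum>w\<in>UNIV. fill_go i t w) = mixing_cost i"
proof (rule antisym)
  obtain v where v: "\<And>t. fill_go i t v = 0"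
    by (rule fill_halting_state[of i]) blast
  have "- G i v = \<pi> v * (\<Sum>t. \<Sum>w\<in>UNIV. fill_go i t w)"
    using flow_green_identity[OF flow_fill fill_summable fill_stop_sums, where i = i and k = v]
    by (simp add: sum_\<pi>_G v)
  then have "(\<Sum>t. \<Sum>w\<in>UNIV. fill_go i t w) = - G i v / \<pi> v"
    using \<pi>_pos[of v] by simp
  then show "(\<Sum>t. \<Sum>w\<in>UNIV. fill_go i t w) \<le> mixing_cost i"
    by (simp add: mixing_cost_def)
  show "mixing_cost i \<le> (\<Sum>t. \<Sum>w\<in>UNIV. fill_go i t w)"
    unfolding mixing_cost_def
    using flow_stationary_lower_bound[OF flow_fill fill_summable fill_stop_sums]
    by (subst Max_le_iff) auto
qed

end

section \<open>Markov property of the randomized walk\<close>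

abbreviation paths :: "(nat \<Rightarrow> 'n) measure" where
  "paths \<equiv> PiM UNIV (\<lambda>_. count_space UNIV)"

lemma sets_walk [measurable_cong]: "sets (walk E i) = sets paths"
proof -
  interpret IT: Ionescu_Tulcea "walk_kernel E i" "\<lambda>_. count_space UNIV"
    by (rule Ionescu_Tulcea_walk)
  show ?thesis
    unfolding walk_def by (rule IT.PF.sets_lim)
qed

lemma space_walk [simp]: "space (walk E i) = UNIV"
  using sets_eq_imp_space_eq[OF sets_walk] by (simp add: space_PiM)

lemma cylinder_sets [measurable]: "{x. \<forall>t\<le>n. x t = y t} \<in> sets (walk E i)"
  for E :: "'n::finite \<Rightarrow> 'n \<Rightarrow> bool"
proof -
  have "{x \<in> space paths. \<forall>t\<le>n. x t = y t} \<in> sets (paths :: (nat \<Rightarrow> 'n) measure)"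
    by measurable
  then show ?thesis by (simp add: sets_walk space_PiM)
qed

text \<open>A set of trajectories determined by the first \<open>n + 1\<close> positions is a finite union of cylinders.\<close>

lemma walk_determined_sum:
  fixes E :: "'n::finite \<Rightarrow> 'n \<Rightarrow> bool"
  assumes det: "\<And>x x'. (\<And>t. t \<le> n \<Longrightarrow> x t = x' t) \<Longrightarrow> x \<in> A \<Longrightarrow> x' \<in> A"
  assumes C: "C \<in> sets (walk E i)"
  shows "emeasure (walk E i) (A \<inter> C) =
      (\<Sum>y\<in>(\<lambda>x. restrict x {..n}) ` A. emeasure (walk E i) ({x. \<forall>t\<le>n. x t = y t} \<inter> C))"
proof -
  define Y where "Y = (\<lambda>x. restrict x {..n}) ` A"
  have "Y \<subseteq> PiE {..n} (\<lambda>_. UNIV)"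
    by (auto simp: Y_def split: if_splits)
  then have Y: "finite Y"
    by (rule finite_subset) (simp add: finite_PiE)
  have A: "A \<inter> C = (\<Union>y\<in>Y. {x. \<forall>t\<le>n. x t = y t} \<inter> C)"
  proof safe
    fix x assume "x \<in> A" "x \<in> C"
    then show "x \<in> (\<Union>y\<in>Y. {x. \<forall>t\<le>n. x t = y t} \<inter> C)"
      by (intro UN_I[of "restrict x {..n}"]) (auto simp: Y_def)
  next
    fix x y assume "y \<in> Y" "\<forall>t\<le>n. x t = y t"
    then obtain x' where "x' \<in> A" "y = restrict x' {..n}"
      by (auto simp: Y_def)
    with \<open>\<forall>t\<le>n. x t = y t\<close> show "x \<in> A"
      by (intro det[of x' x]) auto
  qed
  have dis: "disjoint_family_on (\<lambda>y. {x. \<forall>t\<le>n. x t = y t} \<inter> C) Y"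
    unfolding disjoint_family_on_def
  proof (intro ballI impI)
    \<comment> \<open>All members of \<open>Y\<close> are \<open>undefined\<close> after time
      \<open>n\<close>, so distinct ones differ at some time up to \<open>n\<close> and give
      disjoint cylinders.\<close>
    fix y z assume yz: "y \<in> Y" "z \<in> Y" "y \<noteq> z"
    have "y = z" if "\<forall>t\<le>n. x t = y t" "\<forall>t\<le>n. x t = z t" for x
      using that yz by (auto simp: Y_def restrict_def fun_eq_iff)
    with yz show "({x. \<forall>t\<le>n. x t = y t} \<inter> C) \<inter> ({x. \<forall>t\<le>n. x t = z t} \<inter> C) = {}"
      by blast
  qed
  have "(\<Sum>y\<in>Y. emeasure (walk E i) ({x. \<forall>t\<le>n. x t = y t} \<inter> C)) = emeasure (walk E i) (A \<inter> C)"
    unfolding A using Y C dis by (intro sum_emeasure) (auto intro!: sets.Int cylinder_sets)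
  then show "emeasure (walk E i) (A \<inter> C) =
      (\<Sum>y\<in>(\<lambda>x. restrict x {..n}) ` A. emeasure (walk E i) ({x. \<forall>t\<le>n. x t = y t} \<inter> C))"
    by (simp add: Y_def)
qed

lemma coordinate_sets [measurable]: "{x. x t = v} \<in> sets (walk E i)"
  for E :: "'n::finite \<Rightarrow> 'n \<Rightarrow> bool"
proof -
  have "{x \<in> space paths. x t = v} \<in> sets (paths :: (nat \<Rightarrow> 'n) measure)"
    by measurable
  then show ?thesis by (simp add: sets_walk space_PiM)
qed

text \<open>On each cylinder in the decomposition of the past event, prescribing one more position
  multiplies the probability by the same factor \<open>pmf (step E u) v\<close>, which can be taken
  out of the sum.\<close>

lemma walk_markov:
  fixes E :: "'n::finite \<Rightarrow> 'n \<Rightarrow> bool"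
  assumes det: "\<And>x x'. (\<And>t. t \<le> n \<Longrightarrow> x t = x' t) \<Longrightarrow> x \<in> A \<Longrightarrow> x' \<in> A"
  shows "emeasure (walk E i) (A \<inter> {x. x n = u \<and> x (Suc n) = v}) =
    emeasure (walk E i) (A \<inter> {x. x n = u}) * pmf (step E u) v"
proof -
  let ?A = "A \<inter> {x. x n = u}" and ?Y = "(\<lambda>x. restrict x {..n}) ` (A \<inter> {x. x n = u})"
  have det': "x' \<in> ?A" if "\<And>t. t \<le> n \<Longrightarrow> x t = x' t" "x \<in> ?A" for x x'
    using that det[of x x'] by auto
  have UNIV: "UNIV \<in> sets (walk E i)"
    using sets.top[of "walk E i"] by simp
  have "emeasure (walk E i) (?A \<inter> {x. x (Suc n) = v}) =
      (\<Sum>y\<in>?Y. emeasure (walk E i) ({x. \<forall>t\<le>n. x t = y t} \<inter> {x. x (Suc n) = v}))"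
    by (rule walk_determined_sum[OF det' coordinate_sets])
  also have "\<dots> = (\<Sum>y\<in>?Y. emeasure (walk E i) {x. \<forall>t\<le>n. x t = y t} * pmf (step E u) v)"
  proof (rule sum.cong[OF refl])
    fix y assume "y \<in> ?Y"
    then have y: "y n = u" by auto
    have "{x. \<forall>t\<le>n. x t = y t} \<inter> {x. x (Suc n) = v} = {x. \<forall>t\<le>Suc n. x t = (y(Suc n := v)) t}"
      by (auto simp: le_Suc_eq)
    then show "emeasure (walk E i) ({x. \<forall>t\<le>n. x t = y t} \<inter> {x. x (Suc n) = v}) =
        emeasure (walk E i) {x. \<forall>t\<le>n. x t = y t} * pmf (step E u) v"
      unfolding emeasure_walk_cylinder by (simp only: emeasure_walk_cylinder) (simp add: y mult.assoc)
  qed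
  also have "\<dots> = emeasure (walk E i) (?A \<inter> UNIV) * pmf (step E u) v"
  proof -
    have eq: "emeasure (walk E i) (?A \<inter> UNIV) =
        (\<Sum>y\<in>?Y. emeasure (walk E i) ({x. \<forall>t\<le>n. x t = y t} \<inter> UNIV))"
      by (rule walk_determined_sum[OF det' UNIV])
    show ?thesis
      unfolding eq by (simp only: Int_UNIV_right sum_distrib_right)
  qed
  finally show ?thesis
    by (simp add: Int_assoc Collect_conj_eq)
qed

lemma emeasure_walk_start: "emeasure (walk E i) {x. x 0 = v} = of_bool (v = i)"
  using emeasure_walk_cylinder[of E i 0 "\<lambda>_. v"] by simp

lemma prob_space_walk: "prob_space (walk E i)"
  for E :: "'n::finite \<Rightarrow> 'n \<Rightarrow> bool"
proof
  have "emeasure (walk E i) (\<Union>v\<in>UNIV. {x. x 0 = v}) = (\<Sum>v\<in>UNIV. emeasure (walk E i) {x. x 0 = v})"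
    by (intro sum_emeasure[symmetric]) (auto simp: disjoint_family_on_def)
  also have "\<dots> = 1"
    by (simp add: emeasure_walk_start)
  also have "(\<Union>v\<in>UNIV. {x :: nat \<Rightarrow> 'n. x 0 = v}) = UNIV"
    by auto
  finally show "emeasure (walk E i) (space (walk E i)) = 1"
    by simp
qed

section \<open>The walk together with its independent uniform variable\<close>

lemma prob_space_uniform: "prob_space (uniform_measure lborel {0..1::real})"
  by (rule prob_space_uniform_measure) auto

lemma pair_prob_space_walk: "pair_prob_space (walk E i) (uniform_measure lborel {0..1::real})"
  by (intro pair_prob_space.intro pair_sigma_finite.intro prob_space_imp_sigma_finite
      prob_space_walk prob_space_uniform)

lemma prob_space_rand_walk: "prob_space (rand_walk E i)"
proof -
  interpret pair_prob_space "walk E i" "uniform_measure lborel {0..1::real}"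
    by (rule pair_prob_space_walk)
  show ?thesis
    unfolding rand_walk_def by (rule prob_space_axioms)
qed

lemma sets_rand_walk [measurable_cong]: "sets (rand_walk E i) = sets (paths \<Otimes>\<^sub>M borel)"
  unfolding rand_walk_def by (intro sets_pair_measure_cong) (simp_all add: sets_walk)

lemma space_rand_walk [simp]: "space (rand_walk E i) = UNIV"
  by (simp add: rand_walk_def space_pair_measure)

lemma space_rand_filtration [simp]: "space (rand_filtration t) = UNIV"
  by (simp add: rand_filtration_def)

lemma rand_filtration_sets_iff:
  "A \<in> sets (rand_filtration t) \<longleftrightarrow>
    (\<exists>B\<in>sets (PiM {s. enat s \<le> t} (\<lambda>_. count_space UNIV) \<Otimes>\<^sub>M borel).
      A = (\<lambda>(x, u). (restrict x {s. enat s \<le> t}, u)) -` B)"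
  unfolding rand_filtration_def
  by (subst sets_vimage_algebra2) (auto simp: space_pair_measure space_PiM split: if_splits)

lemma rand_filtration_subset: "sets (rand_filtration t) \<subseteq> sets (rand_walk E i)"
  for E :: "'n::finite \<Rightarrow> 'n \<Rightarrow> bool"
proof
  fix A assume "A \<in> sets (rand_filtration t :: ((nat \<Rightarrow> 'n) \<times> real) measure)"
  then obtain B where B: "B \<in> sets (PiM {s. enat s \<le> t} (\<lambda>_. count_space UNIV) \<Otimes>\<^sub>M borel)"
    and A: "A = (\<lambda>(x :: nat \<Rightarrow> 'n, u :: real). (restrict x {s. enat s \<le> t}, u)) -` B"
    by (auto simp: rand_filtration_sets_iff)
  have "(\<lambda>(x, u). (restrict x {s. enat s \<le> t}, u)) \<in>
      (paths \<Otimes>\<^sub>M borel) \<rightarrow>\<^sub>M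
      (PiM {s. enat s \<le> t} (\<lambda>_. count_space (UNIV :: 'n set)) \<Otimes>\<^sub>M (borel :: real measure))"
    unfolding case_prod_beta by (intro measurable_Pair measurable_restrict) measurable
  from measurable_sets[OF this B] show "A \<in> sets (rand_walk E i)"
    by (simp add: A sets_rand_walk space_pair_measure space_PiM)
qed

lemma rand_filtration_determined:
  assumes "A \<in> sets (rand_filtration (enat n))" "\<And>t. t \<le> n \<Longrightarrow> x t = x' t" "(x, u) \<in> A"
  shows "(x', u) \<in> A"
proof -
  have "restrict x {s. enat s \<le> enat n} = restrict x' {s. enat s \<le> enat n}"
    using assms(2) by (auto simp: fun_eq_iff)
  then show ?thesis
    using assms(1,3) by (auto simp: rand_filtration_sets_iff)
qed

lemma rand_filtration_coordinate:
  assumes "enat s \<le> t"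
  shows "(\<lambda>\<omega>. fst \<omega> s) \<in> rand_filtration t \<rightarrow>\<^sub>M count_space UNIV"
proof -
  let ?f = "\<lambda>(x, u). (restrict x {s. enat s \<le> t}, u)"
  have "?f \<in> rand_filtration t \<rightarrow>\<^sub>M (PiM {s. enat s \<le> t} (\<lambda>_. count_space UNIV) \<Otimes>\<^sub>M borel)"
    unfolding rand_filtration_def
    by (rule measurable_vimage_algebra1) (auto simp: space_pair_measure space_PiM split: if_splits)
  moreover have "(\<lambda>\<omega>. fst \<omega> s) \<in>
      (PiM {s. enat s \<le> t} (\<lambda>_. count_space UNIV) \<Otimes>\<^sub>M borel) \<rightarrow>\<^sub>M count_space UNIV"
    by (rule measurable_compose[OF measurable_fst measurable_component_singleton]) (simp add: assms)
  ultimately have "(\<lambda>\<omega>. fst (?f \<omega>) s) \<in> rand_filtration t \<rightarrow>\<^sub>M count_space UNIV"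
    by (rule measurable_compose)
  then show ?thesis
    using assms by (simp add: case_prod_beta)
qed

lemma rand_filtration_snd: "snd \<in> rand_filtration t \<rightarrow>\<^sub>M borel"
proof -
  let ?f = "\<lambda>(x, u). (restrict x {s. enat s \<le> t}, u)"
  have "?f \<in> rand_filtration t \<rightarrow>\<^sub>M (PiM {s. enat s \<le> t} (\<lambda>_. count_space UNIV) \<Otimes>\<^sub>M borel)"
    unfolding rand_filtration_def
    by (rule measurable_vimage_algebra1) (auto simp: space_pair_measure space_PiM split: if_splits)
  then have "(\<lambda>\<omega>. snd (?f \<omega>)) \<in> rand_filtration t \<rightarrow>\<^sub>M borel"
    by (rule measurable_compose) measurable
  then show ?thesis
    by (simp add: case_prod_beta)
qed

text \<open>By Fubini the uniform variable can be frozen at a value \<open>z\<close>: the slice of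
  \<open>A\<close> at \<open>z\<close> depends only on the positions up to time \<open>n\<close>, so
  \<open>walk_markov\<close> applies under the integral.\<close>

lemma rand_walk_markov:
  fixes E :: "'n::finite \<Rightarrow> 'n \<Rightarrow> bool"
  assumes A: "A \<in> sets (rand_filtration (enat n))"
  shows "measure (rand_walk E i) (A \<inter> {\<omega>. fst \<omega> n = u \<and> fst \<omega> (Suc n) = v}) =
    measure (rand_walk E i) (A \<inter> {\<omega>. fst \<omega> n = u}) * pmf (step E u) v"
proof -
  interpret PP: pair_prob_space "walk E i" "uniform_measure lborel {0..1::real}"
    by (rule pair_prob_space_walk)
  have A': "A \<in> sets (rand_walk E i)"
    using A rand_filtration_subset by blast
  have sets: "A \<inter> {\<omega>. Q (fst \<omega>)} \<in> sets (walk E i \<Otimes>\<^sub>M uniform_measure lborel {0..1::real})"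
    if "{x. Q x} \<in> sets (walk E i)" for Q
  proof -
    have "fst -` {x. Q x} \<inter> space (rand_walk E i) \<in> sets (rand_walk E i)"
      using that by (intro measurable_sets[of _ _ "walk E i"]) (simp_all add: rand_walk_def)
    from sets.Int[OF A' this] have "A \<inter> {\<omega>. Q (fst \<omega>)} \<in> sets (rand_walk E i)"
      by (simp add: vimage_def)
    then show ?thesis
      by (simp only: rand_walk_def)
  qed
  have "{x. x n = u \<and> x (Suc n) = v} \<in> sets (walk E i)"
    using sets.Int[OF coordinate_sets[of n u E i] coordinate_sets[of "Suc n" v E i]]
    by (simp add: Collect_conj_eq)
  note s2 = sets[OF this] and s1 = sets[OF coordinate_sets]
  have "emeasure (rand_walk E i) (A \<inter> {\<omega>. fst \<omega> n = u \<and> fst \<omega> (Suc n) = v}) =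
      (\<integral>\<^sup>+z. emeasure (walk E i) ((\<lambda>x. (x, z)) -` A \<inter> {x. x n = u \<and> x (Suc n) = v})
        \<partial>uniform_measure lborel {0..1})"
  proof -
    have "(\<lambda>x. (x, z)) -` (A \<inter> {\<omega>. fst \<omega> n = u \<and> fst \<omega> (Suc n) = v}) =
        (\<lambda>x. (x, z)) -` A \<inter> {x. x n = u \<and> x (Suc n) = v}" for z
      by auto
    then show ?thesis
      unfolding rand_walk_def by (subst PP.emeasure_pair_measure_alt2[OF s2]) (simp only:)
  qed
  also have "\<dots> = (\<integral>\<^sup>+z. emeasure (walk E i) ((\<lambda>x. (x, z)) -` (A \<inter> {\<omega>. fst \<omega> n = u})) * pmf (step E u) v
        \<partial>uniform_measure lborel {0..1})"
  proof (rule nn_integral_cong)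
    fix z :: real
    have det: "x' \<in> (\<lambda>x. (x, z)) -` A" if "\<And>t. t \<le> n \<Longrightarrow> x t = x' t" "x \<in> (\<lambda>x. (x, z)) -` A" for x x'
      using rand_filtration_determined[OF A that(1), where u = z] that(2) by simp
    have eq: "(\<lambda>x. (x, z)) -` (A \<inter> {\<omega>. fst \<omega> n = u}) = (\<lambda>x. (x, z)) -` A \<inter> {x. x n = u}"
      by auto
    show "emeasure (walk E i) ((\<lambda>x. (x, z)) -` A \<inter> {x. x n = u \<and> x (Suc n) = v}) =
        emeasure (walk E i) ((\<lambda>x. (x, z)) -` (A \<inter> {\<omega>. fst \<omega> n = u})) * pmf (step E u) v"
      unfolding eq by (rule walk_markov) (fact det)
  qed
  also have "\<dots> = emeasure (rand_walk E i) (A \<inter> {\<omega>. fst \<omega> n = u}) * pmf (step E u) v"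
    unfolding rand_walk_def PP.emeasure_pair_measure_alt2[OF s1]
    by (rule nn_integral_multc) (rule PP.measurable_emeasure_Pair2[OF s1])
  finally show ?thesis
    by (simp add: measure_def enn2real_mult)
qed

lemma measure_rand_walk_fst:
  assumes "A \<in> sets (walk E i)"
  shows "measure (rand_walk E i) {\<omega>. fst \<omega> \<in> A} = measure (walk E i) A"
proof -
  interpret PP: pair_prob_space "walk E i" "uniform_measure lborel {0..1::real}"
    by (rule pair_prob_space_walk)
  have "{\<omega>. fst \<omega> \<in> A} = A \<times> space (uniform_measure lborel {0..1::real})"
    by auto
  then have "emeasure (rand_walk E i) {\<omega>. fst \<omega> \<in> A} =
      emeasure (walk E i) A * emeasure (uniform_measure lborel {0..1::real}) (space (uniform_measure lborel {0..1::real}))"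
    unfolding rand_walk_def using assms by (simp only: PP.M2.emeasure_pair_measure_Times sets.top)
  then show ?thesis
    by (simp only: PP.M2.emeasure_space_1 mult_1_right measure_def)
qed

lemma nn_integral_rand_walk_fst:
  assumes "f \<in> borel_measurable (walk E i)"
  shows "(\<integral>\<^sup>+\<omega>. f (fst \<omega>) \<partial>rand_walk E i) = (\<integral>\<^sup>+x. f x \<partial>walk E i)"
proof -
  interpret PP: pair_prob_space "walk E i" "uniform_measure lborel {0..1::real}"
    by (rule pair_prob_space_walk)
  have "(\<lambda>\<omega>. f (fst \<omega>)) \<in> borel_measurable (walk E i \<Otimes>\<^sub>M uniform_measure lborel {0..1::real})"
    using assms by measurable
  from PP.M2.nn_integral_fst[OF this] show ?thesis
    by (simp add: rand_walk_def PP.M2.emeasure_space_1)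
qed

text \<open>Countability of \<open>enat\<close> upgrades Borel measurability to the discrete
  sigma-algebra, so arbitrary predicates of the stopping time define events.\<close>

lemma stopping_time_measurable:
  fixes E :: "'n::finite \<Rightarrow> 'n \<Rightarrow> bool"
  assumes "stopping_time rand_filtration T"
  shows "T \<in> rand_walk E i \<rightarrow>\<^sub>M count_space UNIV"
proof -
  have "T \<in> borel_measurable (rand_walk E i)"
    by (rule measurable_stopping_time[OF assms]) (simp_all add: rand_filtration_subset)
  then have "T -` {t} \<inter> space (rand_walk E i) \<in> sets (rand_walk E i)" for t
    by (rule measurable_sets) simp
  then show ?thesis
    by (subst measurable_count_space_eq_countable) auto
qed

lemma stopping_time_position_sets:
  fixes E :: "'n::finite \<Rightarrow> 'n \<Rightarrow> bool"
  assumes "stopping_time rand_filtration T"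
  shows "{\<omega>. Q (fst \<omega> s) (fst \<omega> t) (T \<omega>)} \<in> sets (rand_walk E i)"
proof -
  have coord: "{\<omega>. fst \<omega> t = v} \<in> sets (rand_walk E i)" for t v
  proof -
    have "fst -` {x. x t = v} \<inter> space (rand_walk E i) \<in> sets (rand_walk E i)"
      by (intro measurable_sets[of _ _ "walk E i"]) (simp_all add: rand_walk_def coordinate_sets)
    then show ?thesis by (simp add: vimage_def)
  qed
  have "T -` {e. Q u v e} \<inter> space (rand_walk E i) \<in> sets (rand_walk E i)" for u v
    by (rule measurable_sets[OF stopping_time_measurable[OF assms]]) simp
  then have event: "{\<omega>. Q u v (T \<omega>)} \<in> sets (rand_walk E i)" for u v
    by (simp add: vimage_def)
  have "{\<omega>. Q (fst \<omega> s) (fst \<omega> t) (T \<omega>)} =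
      (\<Union>u\<in>UNIV. \<Union>v\<in>UNIV. {\<omega>. fst \<omega> s = u} \<inter> {\<omega>. fst \<omega> t = v} \<inter> {\<omega>. Q u v (T \<omega>)})"
    by auto
  also have "\<dots> \<in> sets (rand_walk E i)"
    by (intro sets.finite_UN sets.Int coord event finite_class.finite_UNIV)
  finally show ?thesis .
qed

lemma emeasure_uniform_lessThan:
  assumes "0 \<le> c" "c \<le> 1"
  shows "emeasure (uniform_measure lborel {0..1::real}) {u. u < c} = ennreal c"
proof -
  have "{0..1} \<inter> {u. u < c} = {0..<c}"
    using assms by auto
  then show ?thesis
    using assms by (simp add: divide_ennreal_def)
qed

text \<open>Fubini with the trajectory held fixed: the uniform variable lies below the threshold
  with probability \<open>g x\<close>. This converts prescribed survival probabilities into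
  events.\<close>

lemma emeasure_rand_walk_threshold:
  fixes E :: "'n::finite \<Rightarrow> 'n \<Rightarrow> bool"
  assumes C: "C \<in> sets (walk E i)" and g: "g \<in> borel_measurable (walk E i)" "\<And>x. 0 \<le> g x" "\<And>x. g x \<le> 1"
  shows "emeasure (rand_walk E i) {\<omega>. fst \<omega> \<in> C \<and> snd \<omega> < g (fst \<omega>)} =
    (\<integral>\<^sup>+x. ennreal (g x) * indicator C x \<partial>walk E i)"
proof -
  interpret PP: pair_prob_space "walk E i" "uniform_measure lborel {0..1::real}"
    by (rule pair_prob_space_walk)
  let ?A = "{\<omega>. fst \<omega> \<in> C \<and> snd \<omega> < g (fst \<omega>)}" and ?M = "walk E i \<Otimes>\<^sub>M uniform_measure lborel {0..1::real}"
  have "{\<omega> \<in> space ?M. fst \<omega> \<in> C \<and> snd \<omega> < g (fst \<omega>)} \<in> sets ?M"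
    using C g(1) by measurable
  then have "?A \<in> sets ?M"
    by (simp add: space_pair_measure)
  then have "emeasure (rand_walk E i) ?A =
      (\<integral>\<^sup>+x. emeasure (uniform_measure lborel {0..1::real}) (Pair x -` ?A) \<partial>walk E i)"
    unfolding rand_walk_def by (rule PP.M2.emeasure_pair_measure_alt)
  also have "\<dots> = (\<integral>\<^sup>+x. ennreal (g x) * indicator C x \<partial>walk E i)"
  proof (rule nn_integral_cong)
    fix x
    have "Pair x -` ?A = (if x \<in> C then {u. u < g x} else {})"
      by auto
    then show "emeasure (uniform_measure lborel {0..1::real}) (Pair x -` ?A) = ennreal (g x) * indicator C x"
      using emeasure_uniform_lessThan[OF g(2,3)] by simp
  qed
  finally show ?thesis .
qed

section \<open>First entrance times\<close>

lemma INF_enat_le_iff: "(INF t\<in>{t. Q t}. enat t) \<le> enat n \<longleftrightarrow> (\<exists>t\<le>n. Q t)"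
proof
  assume "(INF t\<in>{t. Q t}. enat t) \<le> enat n"
  moreover have "enat (Suc n) \<le> (INF t\<in>{t. Q t}. enat t)" if "\<not> (\<exists>t\<le>n. Q t)"
    using that by (intro INF_greatest) (auto simp: not_le Suc_le_eq)
  ultimately show "\<exists>t\<le>n. Q t"
    using order_trans by fastforce
next
  assume "\<exists>t\<le>n. Q t"
  then obtain t where "t \<le> n" "Q t" by auto
  then have "(INF t\<in>{t. Q t}. enat t) \<le> enat t"
    by (intro INF_lower) simp
  also have "\<dots> \<le> enat n"
    using \<open>t \<le> n\<close> by simp
  finally show "(INF t\<in>{t. Q t}. enat t) \<le> enat n" .
qed

lemma rand_filtration_mono:
  assumes "s \<le> t"
  shows "sets (rand_filtration s) \<subseteq> sets (rand_filtration t)"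
proof
  fix A assume "A \<in> sets (rand_filtration s :: ((nat \<Rightarrow> 'n) \<times> real) measure)"
  then obtain B where B: "B \<in> sets (PiM {r. enat r \<le> s} (\<lambda>_. count_space UNIV) \<Otimes>\<^sub>M borel)"
    and A: "A = (\<lambda>(x :: nat \<Rightarrow> 'n, u :: real). (restrict x {r. enat r \<le> s}, u)) -` B"
    by (auto simp: rand_filtration_sets_iff)
  have "(\<lambda>(x, u). (restrict x {r. enat r \<le> s}, u)) \<in> rand_filtration t \<rightarrow>\<^sub>M
      (PiM {r. enat r \<le> s} (\<lambda>_. count_space (UNIV :: 'n set)) \<Otimes>\<^sub>M (borel :: real measure))"
    unfolding case_prod_beta using assms
    by (intro measurable_Pair measurable_restrict rand_filtration_coordinate rand_filtration_snd) auto
  from measurable_sets[OF this B] show "A \<in> sets (rand_filtration t)"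
    by (simp add: A)
qed

text \<open>Serves both \<open>hitting_time\<close> and \<open>fill_rule\<close>. That entrance has
  occurred by time \<open>n\<close> is a finite union of events known by then; an infimum over the
  empty set means that it never occurs.\<close>

lemma stopping_time_INF:
  assumes "\<And>n. {\<omega>. Q n \<omega>} \<in> sets (rand_filtration (enat n))"
  shows "stopping_time rand_filtration (\<lambda>\<omega>. INF t\<in>{t. Q t \<omega>}. enat t)"
proof
  fix t
  show "Measurable.pred (rand_filtration t) (\<lambda>\<omega>. (INF t\<in>{t. Q t \<omega>}. enat t) \<le> t)"
  proof (cases t)
    case (enat n)
    have "{\<omega>. \<exists>s\<le>n. Q s \<omega>} = (\<Union>s\<in>{..n}. {\<omega>. Q s \<omega>})"
      by auto
    also have "\<dots> \<in> sets (rand_filtration (enat n))"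
    proof (rule sets.finite_UN)
      show "{\<omega>. Q s \<omega>} \<in> sets (rand_filtration (enat n))" if "s \<in> {..n}" for s
        using that by (intro subsetD[OF rand_filtration_mono assms]) simp
    qed simp
    finally show ?thesis
      unfolding enat INF_enat_le_iff by (simp add: pred_def)
  next
    case infinity
    then show ?thesis by simp
  qed
qed

section \<open>Stopping times as mass flows\<close>

context graph_spectrum
begin

definition pass_mass :: "'n \<Rightarrow> ((nat \<Rightarrow> 'n) \<times> real \<Rightarrow> enat) \<Rightarrow> nat \<Rightarrow> 'n \<Rightarrow> real" where
  "pass_mass i T t v = measure (rand_walk E i) {\<omega>. fst \<omega> t = v \<and> enat t < T \<omega>}"

definition stop_mass :: "'n \<Rightarrow> ((nat \<Rightarrow> 'n) \<times> real \<Rightarrow> enat) \<Rightarrow> nat \<Rightarrow> 'n \<Rightarrow> real" where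
  "stop_mass i T t v = measure (rand_walk E i) {\<omega>. fst \<omega> t = v \<and> T \<omega> = enat t}"

lemma pass_plus_stop:
  assumes "stopping_time rand_filtration T"
  shows "pass_mass i T t v + stop_mass i T t v =
    measure (rand_walk E i) {\<omega>. fst \<omega> t = v \<and> enat t \<le> T \<omega>}"
proof -
  interpret prob_space "rand_walk E i"
    by (rule prob_space_rand_walk)
  have "{\<omega>. fst \<omega> t = v \<and> enat t \<le> T \<omega>} =
      {\<omega>. fst \<omega> t = v \<and> enat t < T \<omega>} \<union> {\<omega>. fst \<omega> t = v \<and> T \<omega> = enat t}"
    by auto
  then show ?thesis
    unfolding pass_mass_def stop_mass_def
    using stopping_time_position_sets[OF assms, where t = t and Q = "\<lambda>_ u e. u = v \<and> enat t < e"]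
      stopping_time_position_sets[OF assms, where t = t and Q = "\<lambda>_ u e. u = v \<and> e = enat t"]
    by (simp only:) (subst finite_measure_Union, auto)
qed

text \<open>This is where adaptedness is used: the event \<open>enat t < T \<omega>\<close> belongs
  to the information at time \<open>t\<close>, so the mass passing at time \<open>t\<close> moves on
  according to \<open>P\<close>. It arrives at time \<open>Suc t\<close> because \<open>T\<close>
  exceeds \<open>t\<close> exactly when it is at least \<open>Suc t\<close>.\<close>

lemma flow_stopping_time:
  assumes T: "stopping_time rand_filtration T"
  shows "flow i (pass_mass i T) (stop_mass i T)"
  unfolding flow_def
proof (intro conjI allI)
  interpret prob_space "rand_walk E i"
    by (rule prob_space_rand_walk)
  fix t v
  show "0 \<le> pass_mass i T t v" "0 \<le> stop_mass i T t v"
    by (simp_all add: pass_mass_def stop_mass_def)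
  show "pass_mass i T 0 v + stop_mass i T 0 v = of_bool (v = i)"
    unfolding pass_plus_stop[OF T]
    using measure_rand_walk_fst[OF coordinate_sets, of E i 0 v] emeasure_walk_start[of E i v]
    by (simp add: measure_def flip: zero_enat_def)
  have A: "{\<omega>. enat t < T \<omega>} \<in> sets (rand_filtration (enat t))"
    using stopping_timeD2[OF T, of "enat t"] by (simp add: pred_def)
  have "{\<omega>. fst \<omega> (Suc t) = v \<and> enat (Suc t) \<le> T \<omega>} =
      (\<Union>u\<in>UNIV. {\<omega>. enat t < T \<omega>} \<inter> {\<omega>. fst \<omega> t = u \<and> fst \<omega> (Suc t) = v})"
    by (auto simp: Suc_ile_eq)
  moreover have "prob (\<Union>u\<in>UNIV. {\<omega>. enat t < T \<omega>} \<inter> {\<omega>. fst \<omega> t = u \<and> fst \<omega> (Suc t) = v}) =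
      (\<Sum>u\<in>UNIV. prob ({\<omega>. enat t < T \<omega>} \<inter> {\<omega>. fst \<omega> t = u \<and> fst \<omega> (Suc t) = v}))"
  proof (rule finite_measure_finite_Union)
    show "(\<lambda>u. {\<omega>. enat t < T \<omega>} \<inter> {\<omega>. fst \<omega> t = u \<and> fst \<omega> (Suc t) = v}) ` UNIV \<subseteq> events"
    proof safe
      fix u
      have "{\<omega>. enat t < T \<omega>} \<inter> {\<omega>. fst \<omega> t = u \<and> fst \<omega> (Suc t) = v} =
          {\<omega>. fst \<omega> t = u \<and> fst \<omega> (Suc t) = v \<and> enat t < T \<omega>}"
        by auto
      then show "{\<omega>. enat t < T \<omega>} \<inter> {\<omega>. fst \<omega> t = u \<and> fst \<omega> (Suc t) = v} \<in> events"
        using stopping_time_position_sets[OF T, where s = t and t = "Suc t" and Q = "\<lambda>x y e. x = u \<and> y = v \<and> enat t < e"]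
        by (simp only:)
    qed
  qed (auto simp: disjoint_family_on_def)
  moreover have "prob ({\<omega>. enat t < T \<omega>} \<inter> {\<omega>. fst \<omega> t = u \<and> fst \<omega> (Suc t) = v}) =
      pass_mass i T t u * P u v" for u
    unfolding rand_walk_markov[OF A] pmf_step[OF deg_pos] pass_mass_def
    by (simp add: Int_def conj_commute)
  ultimately show "pass_mass i T (Suc t) v + stop_mass i T (Suc t) v = (\<Sum>u\<in>UNIV. pass_mass i T t u * P u v)"
    unfolding pass_plus_stop[OF T] by simp
qed

text \<open>The tail-sum formula, stated in \<open>ennreal\<close> so that it also covers infinite
  expected length.\<close>

lemma expected_stopping_time:
  assumes T: "stopping_time rand_filtration T"
  shows "(\<integral>\<^sup>+\<omega>. ennreal_of_enat (T \<omega>) \<partial>rand_walk E i) = (\<Sum>t. ennreal (\<Sum>v\<in>UNIV. pass_mass i T t v))"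
proof -
  interpret prob_space "rand_walk E i"
    by (rule prob_space_rand_walk)
  have "emeasure (rand_walk E i) {\<omega>. enat t < T \<omega>} = ennreal (\<Sum>v\<in>UNIV. pass_mass i T t v)" for t
  proof -
    have "{\<omega>. enat t < T \<omega>} = (\<Union>v\<in>UNIV. {\<omega>. fst \<omega> t = v \<and> enat t < T \<omega>})"
      by auto
    moreover have "prob (\<Union>v\<in>UNIV. {\<omega>. fst \<omega> t = v \<and> enat t < T \<omega>}) = (\<Sum>v\<in>UNIV. pass_mass i T t v)"
      unfolding pass_mass_def
    proof (rule finite_measure_finite_Union)
      show "(\<lambda>v. {\<omega>. fst \<omega> t = v \<and> enat t < T \<omega>}) ` UNIV \<subseteq> events"
        using stopping_time_position_sets[OF T, where t = t and Q = "\<lambda>_ u e. u = v \<and> enat t < e" for v]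
        by auto
    qed (auto simp: disjoint_family_on_def)
    ultimately show ?thesis
      by (simp add: emeasure_eq_measure)
  qed
  then show ?thesis
    using nn_integral_enat_function[OF stopping_time_measurable[OF T, of E i]] by simp
qed

lemma stop_mass_sums:
  assumes T: "stopping_time rand_filtration T"
  shows "(\<lambda>t. stop_mass i T t v) sums
    measure (rand_walk E i) {(x, u). \<exists>t. T (x, u) = enat t \<and> x t = v}"
proof -
  interpret prob_space "rand_walk E i"
    by (rule prob_space_rand_walk)
  have "{(x, u). \<exists>t. T (x, u) = enat t \<and> x t = v} = (\<Union>t. {\<omega>. fst \<omega> t = v \<and> T \<omega> = enat t})"
    by auto
  moreover have "(\<lambda>t. stop_mass i T t v) sums prob (\<Union>t. {\<omega>. fst \<omega> t = v \<and> T \<omega> = enat t})"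
    unfolding stop_mass_def
  proof (rule finite_measure_UNION)
    show "range (\<lambda>t. {\<omega>. fst \<omega> t = v \<and> T \<omega> = enat t}) \<subseteq> events"
      using stopping_time_position_sets[OF T, where t = t and Q = "\<lambda>_ u e. u = v \<and> e = enat t" for t]
      by auto
  qed (auto simp: disjoint_family_on_def)
  ultimately show ?thesis by simp
qed

lemma expected_stopping_time_summable:
  assumes "stopping_time rand_filtration T" "summable (\<lambda>t. \<Sum>v\<in>UNIV. pass_mass i T t v)"
  shows "(\<integral>\<^sup>+\<omega>. ennreal_of_enat (T \<omega>) \<partial>rand_walk E i) = ennreal (\<Sum>t. \<Sum>v\<in>UNIV. pass_mass i T t v)"
  unfolding expected_stopping_time[OF assms(1)]
  using flow_nonneg[OF flow_stopping_time[OF assms(1)]] assms(2)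
  by (intro suminf_ennreal2) (auto intro: sum_nonneg)

text \<open>Rules of infinite expected length satisfy the bound trivially; for the others,
  finiteness is exactly the summability required by
  \<open>flow_stationary_lower_bound\<close>.\<close>

lemma mixing_cost_le_stopping_rule:
  assumes "stopping_rule E i (stationary E) T"
  shows "ennreal (mixing_cost i) \<le> (\<integral>\<^sup>+\<omega>. ennreal_of_enat (T \<omega>) \<partial>rand_walk E i)"
proof (cases "(\<integral>\<^sup>+\<omega>. ennreal_of_enat (T \<omega>) \<partial>rand_walk E i) = top")
  case False
  have T: "stopping_time rand_filtration T"
    using assms by (simp add: stopping_rule_def)
  have sums: "(\<lambda>t. stop_mass i T t v) sums \<pi> v" for v
    using assms stop_mass_sums[OF T, of i v] by (simp add: stopping_rule_def)
  have summable: "summable (\<lambda>t. \<Sum>v\<in>UNIV. pass_mass i T t v)"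
    using False flow_nonneg[OF flow_stopping_time[OF T]]
    unfolding expected_stopping_time[OF T]
    by (intro summable_suminf_not_top) (auto intro: sum_nonneg)
  have "mixing_cost i \<le> (\<Sum>t. \<Sum>v\<in>UNIV. pass_mass i T t v)"
    unfolding mixing_cost_def
    using flow_stationary_lower_bound[OF flow_stopping_time[OF T] summable sums]
    by (subst Max_le_iff) auto
  then show ?thesis
    unfolding expected_stopping_time_summable[OF T summable] by (rule ennreal_leI)
qed simp

text \<open>The absence of departures from \<open>j\<close> is used twice: it makes the expected
  length finite, and it removes the departure term from \<open>flow_green_identity\<close>. All mass
  stops at \<open>j\<close>, so the stopped law is the point mass there. The sign is recorded
  because \<open>ennreal\<close> truncates negative reals.\<close>

lemma mean_hitting_eq:
  "mean_hitting E i j = ennreal ((G j j - G i j) / \<pi> j)" "0 \<le> (G j j - G i j) / \<pi> j"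
proof -
  let ?T = "\<lambda>\<omega> :: (nat \<Rightarrow> 'n) \<times> real. hitting_time j (fst \<omega>)"
  have T: "stopping_time rand_filtration ?T"
    unfolding hitting_time_def
  proof (rule stopping_time_INF)
    show "{\<omega> :: (nat \<Rightarrow> 'n) \<times> real. fst \<omega> n = j} \<in> sets (rand_filtration (enat n))" for n
      using measurable_sets[OF rand_filtration_coordinate[of n "enat n"], of "{j}"]
      by (simp add: vimage_def)
  qed
  note flow = flow_stopping_time[OF T, of i]
  have le: "hitting_time j x \<le> enat t" if "x t = j" for x t
    using that unfolding hitting_time_def by (subst INF_enat_le_iff) auto
  have halt: "pass_mass i ?T t j = 0" for t
  proof -
    have "{\<omega> :: (nat \<Rightarrow> 'n) \<times> real. fst \<omega> t = j \<and> enat t < ?T \<omega>} = {}"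
      using le by (auto simp: not_less)
    then show ?thesis
      unfolding pass_mass_def by (simp only: measure_empty)
  qed
  have hit: "x t = j" if h: "hitting_time j x = enat t" for x t
  proof -
    obtain s where s: "s \<le> t" "x s = j"
      using h INF_enat_le_iff[of "\<lambda>t. x t = j" t] unfolding hitting_time_def by auto
    with le[of x s] h show ?thesis by simp
  qed
  have stop: "stop_mass i ?T t v = 0" if "v \<noteq> j" for t v
  proof -
    have "{\<omega> :: (nat \<Rightarrow> 'n) \<times> real. fst \<omega> t = v \<and> ?T \<omega> = enat t} = {}"
      using hit that by auto
    then show ?thesis
      unfolding stop_mass_def by (simp only: measure_empty)
  qed
  have summable: "summable (\<lambda>t. \<Sum>v\<in>UNIV. pass_mass i ?T t v)"
    by (rule flow_summable_halting[OF flow halt])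
  let ?p = "\<lambda>v. \<Sum>t. stop_mass i ?T t v"
  have p: "?p v = of_bool (v = j)" for v
  proof (cases "v = j")
    case True
    have "(\<Sum>v\<in>UNIV. ?p v) = (\<Sum>v\<in>{j}. ?p v)"
      using stop by (intro sum.mono_neutral_right) auto
    then show ?thesis
      using flow_total_stop[OF flow summable] True by simp
  qed (simp add: stop)
  have "(\<Sum>v\<in>UNIV. ?p v * G v j) - G i j =
      \<pi> j * (\<Sum>t. \<Sum>v\<in>UNIV. pass_mass i ?T t v) - (\<Sum>t. pass_mass i ?T t j)"
    by (rule flow_green_identity[OF flow summable summable_sums[OF flow_summable_stop[OF flow]]])
  then have "G j j - G i j = \<pi> j * (\<Sum>t. \<Sum>v\<in>UNIV. pass_mass i ?T t v)"
    unfolding p by (simp add: halt)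
  then have cost: "(\<Sum>t. \<Sum>v\<in>UNIV. pass_mass i ?T t v) = (G j j - G i j) / \<pi> j"
    using \<pi>_pos[of j] by simp
  have "mean_hitting E i j = (\<integral>\<^sup>+\<omega>. ennreal_of_enat (?T \<omega>) \<partial>rand_walk E i)"
  proof -
    \<comment> \<open>The hitting time ignores the uniform variable, so its measurability on
      trajectories follows by fixing that variable at an arbitrary value.\<close>
    have "(\<lambda>x. (x, 0)) \<in> walk E i \<rightarrow>\<^sub>M rand_walk E i"
      unfolding rand_walk_def by (rule measurable_Pair2') simp
    from measurable_compose[OF this stopping_time_measurable[OF T]]
    have "hitting_time j \<in> walk E i \<rightarrow>\<^sub>M count_space UNIV"
      by simp
    then have "(\<lambda>x. ennreal_of_enat (hitting_time j x)) \<in> borel_measurable (walk E i)"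
      by (rule measurable_compose) simp
    from nn_integral_rand_walk_fst[OF this] show ?thesis
      by (simp add: mean_hitting_def)
  qed
  with cost show "mean_hitting E i j = ennreal ((G j j - G i j) / \<pi> j)"
    by (simp add: expected_stopping_time_summable[OF T summable])
  have "0 \<le> (\<Sum>t. \<Sum>v\<in>UNIV. pass_mass i ?T t v)"
    by (intro suminf_nonneg summable sum_nonneg flow_nonneg[OF flow])
  with cost show "0 \<le> (G j j - G i j) / \<pi> j"
    by simp
qed

text \<open>A single uniform variable \<open>u\<close> decides at all times: given the trajectory, the filling rule survives
  the times before \<open>t\<close> with probability \<open>fill_survival i t\<close>, so it stops as soon as this has dropped to
  \<open>u\<close> or below. The junk value \<open>0 / 0 = 0\<close> occurs only where no mass arrives.\<close>

definition fill_survival :: "'n \<Rightarrow> nat \<Rightarrow> (nat \<Rightarrow> 'n) \<Rightarrow> real" where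
  "fill_survival i t x = (\<Prod>s<t. 1 - fill_stop i s (x s) / snd (fill i s) (x s))"

definition fill_rule :: "'n \<Rightarrow> (nat \<Rightarrow> 'n) \<times> real \<Rightarrow> enat" where
  "fill_rule i \<omega> = (INF t\<in>{t. fill_survival i (Suc t) (fst \<omega>) \<le> snd \<omega>}. enat t)"

lemma fill_ratio_bounds:
  "0 \<le> fill_stop i s v / snd (fill i s) v" "fill_stop i s v / snd (fill i s) v \<le> 1"
  using fill_bounds[of i s v] flow_nonneg[OF flow_fill, of i s v]
  by (auto simp: fill_go_def divide_le_eq_1)

lemma fill_survival_bounds: "0 \<le> fill_survival i t x" "fill_survival i t x \<le> 1"
  unfolding fill_survival_def using fill_ratio_bounds by (auto intro!: prod_nonneg prod_le_1)

lemma fill_survival_antimono: "s \<le> t \<Longrightarrow> fill_survival i t x \<le> fill_survival i s x"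
proof (rule lift_Suc_antimono_le[of "\<lambda>t. fill_survival i t x"])
  fix t
  have "fill_survival i (Suc t) x \<le> fill_survival i t x * 1"
    using fill_ratio_bounds[of i t "x t"] fill_survival_bounds(1)[of i t x]
    unfolding fill_survival_def prod.lessThan_Suc by (intro mult_left_mono) auto
  then show "fill_survival i (Suc t) x \<le> fill_survival i t x"
    by simp
qed

text \<open>Survival is antitone in time, so the test at time \<open>t\<close> subsumes all earlier
  ones. The index \<open>Suc t\<close> includes the factor for the vertex occupied at time
  \<open>t\<close>, where the decision to stop is taken.\<close>

lemma less_fill_rule_iff: "enat t < fill_rule i \<omega> \<longleftrightarrow> snd \<omega> < fill_survival i (Suc t) (fst \<omega>)"
proof -
  have "fill_rule i \<omega> \<le> enat t \<longleftrightarrow> (\<exists>s\<le>t. fill_survival i (Suc s) (fst \<omega>) \<le> snd \<omega>)"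
    unfolding fill_rule_def by (rule INF_enat_le_iff)
  also have "\<dots> \<longleftrightarrow> fill_survival i (Suc t) (fst \<omega>) \<le> snd \<omega>"
    using fill_survival_antimono[of "Suc s" "Suc t" i "fst \<omega>" for s] by (force intro: order_trans)
  finally show ?thesis by (simp add: not_le flip: not_less)
qed

lemma stopping_time_fill_rule: "stopping_time rand_filtration (fill_rule i)"
  unfolding fill_rule_def
proof (rule stopping_time_INF)
  fix n
  have "(\<lambda>\<omega>. fill_survival i (Suc n) (fst \<omega>)) \<in> borel_measurable (rand_filtration (enat n))"
    unfolding fill_survival_def
  proof (rule borel_measurable_prod)
    fix s assume "s \<in> {..<Suc n}"
    then have "(\<lambda>\<omega>. fst \<omega> s) \<in> rand_filtration (enat n) \<rightarrow>\<^sub>M count_space (UNIV :: 'n set)"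
      by (intro rand_filtration_coordinate) simp
    then show "(\<lambda>\<omega>. 1 - fill_stop i s (fst \<omega> s) / snd (fill i s) (fst \<omega> s))
        \<in> borel_measurable (rand_filtration (enat n))"
      by (rule measurable_compose) simp
  qed
  from borel_measurable_le[OF this rand_filtration_snd]
  show "{\<omega>. fill_survival i (Suc n) (fst \<omega>) \<le> snd \<omega>} \<in> sets (rand_filtration (enat n))"
    by simp
qed

lemma fill_survival_measurable: "fill_survival i t \<in> borel_measurable (walk E j)"
  unfolding fill_survival_def [abs_def]
proof (rule borel_measurable_prod)
  fix s
  have "(\<lambda>x. x s) \<in> walk E j \<rightarrow>\<^sub>M count_space UNIV"
    unfolding measurable_cong_sets[OF sets_walk refl] by (rule measurable_component_singleton) simp
  then show "(\<lambda>x. 1 - fill_stop i s (x s) / snd (fill i s) (x s)) \<in> borel_measurable (walk E j)"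
    by (rule measurable_compose) simp
qed

lemma emeasure_fill_survival:
  "emeasure (rand_walk E i) {\<omega>. fst \<omega> t = v \<and> snd \<omega> < fill_survival i s (fst \<omega>)} =
    (\<integral>\<^sup>+x. ennreal (fill_survival i s x) * indicator {x. x t = v} x \<partial>walk E i)"
  using emeasure_rand_walk_threshold[OF coordinate_sets fill_survival_measurable fill_survival_bounds]
  by simp

text \<open>On trajectories with \<open>x t = v\<close> the newest factor of the survival product is
  constant and can be pulled out of the integral.\<close>

lemma pass_mass_fill_rule_ratio:
  "pass_mass i (fill_rule i) t v = (1 - fill_stop i t v / snd (fill i t) v) *
    measure (rand_walk E i) {\<omega>. fst \<omega> t = v \<and> snd \<omega> < fill_survival i t (fst \<omega>)}"
proof -
  let ?c = "1 - fill_stop i t v / snd (fill i t) v"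
  have c: "0 \<le> ?c"
    using fill_ratio_bounds(2)[of i t v] by simp
  have "emeasure (rand_walk E i) {\<omega>. fst \<omega> t = v \<and> snd \<omega> < fill_survival i (Suc t) (fst \<omega>)} =
      (\<integral>\<^sup>+x. ennreal ?c * (ennreal (fill_survival i t x) * indicator {x. x t = v} x) \<partial>walk E i)"
    unfolding emeasure_fill_survival
    by (intro nn_integral_cong)
      (auto simp: fill_survival_def indicator_def ennreal_mult'[OF c] mult.commute[of _ ?c])
  also have "\<dots> = ennreal ?c * emeasure (rand_walk E i) {\<omega>. fst \<omega> t = v \<and> snd \<omega> < fill_survival i t (fst \<omega>)}"
    unfolding emeasure_fill_survival
    by (intro nn_integral_cmult borel_measurable_times_ennreal measurable_compose[OF fill_survival_measurable]
        borel_measurable_indicator coordinate_sets) simp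
  finally show ?thesis
    using c by (simp add: pass_mass_def less_fill_rule_iff measure_def enn2real_mult)
qed

text \<open>The induction runs over the arriving mass: \<open>pass\<close> turns arrivals into
  departures, and the flow equation turns departures at time \<open>t\<close> into arrivals at time
  \<open>Suc t\<close>.\<close>

lemma pass_mass_fill_rule: "pass_mass i (fill_rule i) t v = fill_go i t v"
proof -
  have pass: "pass_mass i (fill_rule i) t v = fill_go i t v"
    if "measure (rand_walk E i) {\<omega>. fst \<omega> t = v \<and> snd \<omega> < fill_survival i t (fst \<omega>)} = snd (fill i t) v"
    for t v
    using fill_bounds[of i t v]
    unfolding pass_mass_fill_rule_ratio that
    by (auto simp: fill_go_def fill_stop_def min_def field_simps)
  have arrival: "measure (rand_walk E i) {\<omega>. fst \<omega> t = v \<and> snd \<omega> < fill_survival i t (fst \<omega>)} = snd (fill i t) v"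
    for t v
  proof (induction t arbitrary: v)
    case 0
    have "emeasure (rand_walk E i) {\<omega>. fst \<omega> 0 = v \<and> snd \<omega> < fill_survival i 0 (fst \<omega>)} =
        emeasure (walk E i) {x. x 0 = v}"
      unfolding emeasure_fill_survival using coordinate_sets[of 0 v E i] by (simp add: fill_survival_def)
    then show ?case
      by (simp add: measure_def emeasure_walk_start)
  next
    case (Suc t)
    have "{\<omega>. fst \<omega> (Suc t) = v \<and> snd \<omega> < fill_survival i (Suc t) (fst \<omega>)} =
        {\<omega>. fst \<omega> (Suc t) = v \<and> enat (Suc t) \<le> fill_rule i \<omega>}"
      by (simp add: Suc_ile_eq less_fill_rule_iff)
    then have "measure (rand_walk E i) {\<omega>. fst \<omega> (Suc t) = v \<and> snd \<omega> < fill_survival i (Suc t) (fst \<omega>)} =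
        pass_mass i (fill_rule i) (Suc t) v + stop_mass i (fill_rule i) (Suc t) v"
      by (simp add: pass_plus_stop[OF stopping_time_fill_rule])
    also have "\<dots> = (\<Sum>u\<in>UNIV. pass_mass i (fill_rule i) t u * P u v)"
      using flow_stopping_time[OF stopping_time_fill_rule, of i i] by (simp add: flow_def)
    also have "\<dots> = snd (fill i (Suc t)) v"
      by (simp add: pass[OF Suc] fill_go_def fill_stop_def)
    finally show ?case .
  qed
  show "pass_mass i (fill_rule i) t v = fill_go i t v"
    by (rule pass[OF arrival])
qed

lemma stop_mass_fill_rule: "stop_mass i (fill_rule i) t v = fill_stop i t v"
proof -
  have "pass_mass i (fill_rule i) t v + stop_mass i (fill_rule i) t v = fill_go i t v + fill_stop i t v"
  proof (cases t)
    case 0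
    then show ?thesis
      using flow_stopping_time[OF stopping_time_fill_rule, of i i] flow_fill[of i] by (simp add: flow_def)
  next
    case (Suc s)
    then show ?thesis
      using flow_stopping_time[OF stopping_time_fill_rule, of i i] flow_fill[of i]
      by (simp add: flow_def pass_mass_fill_rule)
  qed
  then show ?thesis
    by (simp add: pass_mass_fill_rule)
qed

lemma stopping_rule_fill_rule: "stopping_rule E i (stationary E) (fill_rule i)"
  unfolding stopping_rule_def
proof (intro conjI allI stopping_time_fill_rule)
  fix v
  show "measure (rand_walk E i) {(x, u). \<exists>t. fill_rule i (x, u) = enat t \<and> x t = v} = \<pi> v"
    using stop_mass_sums[OF stopping_time_fill_rule, of i i v] fill_stop_sums[of i v]
    by (simp add: stop_mass_fill_rule sums_unique2)
qed

lemma H_pi_eq: "H_pi E i = ennreal (mixing_cost i)"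
  unfolding H_pi_def
proof (rule Least_equality)
  have "(\<integral>\<^sup>+\<omega>. ennreal_of_enat (fill_rule i \<omega>) \<partial>rand_walk E i) = ennreal (mixing_cost i)"
    using expected_stopping_time_summable[OF stopping_time_fill_rule, of i i] fill_summable fill_cost
    by (simp add: pass_mass_fill_rule)
  then show "\<exists>T. stopping_rule E i (stationary E) T \<and>
      ennreal (mixing_cost i) = (\<integral>\<^sup>+\<omega>. ennreal_of_enat (T \<omega>) \<partial>rand_walk E i)"
    using stopping_rule_fill_rule by metis
qed (use mixing_cost_le_stopping_rule in blast)

section \<open>The mixing, reset and hitting times\<close>

lemma mixing_cost_nonneg: "0 \<le> mixing_cost i"
  unfolding fill_cost[symmetric]
  by (intro suminf_nonneg fill_summable sum_nonneg flow_nonneg[OF flow_fill])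

lemma mixing_cost_farthest:
  assumes "mean_hitting E f i = Max (range (\<lambda>j. mean_hitting E j i))"
  shows "mixing_cost i = - (vol E / sqrt (deg E i * deg E f) * green_sum i f)"
proof -
  have "- G i k / \<pi> k \<le> - G i f / \<pi> f" for k
  proof -
    have "mean_hitting E k i \<le> mean_hitting E f i"
      unfolding assms by (intro Max_ge) auto
    then have "(G i i - G k i) / \<pi> i \<le> (G i i - G f i) / \<pi> i"
      unfolding mean_hitting_eq(1) ennreal_le_iff[OF mean_hitting_eq(2)] .
    then show ?thesis
      using G_reversible[of i k] G_reversible[of i f] by (simp add: diff_divide_distrib)
  qed
  then have "mixing_cost i = - G i f / \<pi> f"
    unfolding mixing_cost_def by (intro Max_eqI) auto
  also have "\<dots> = - (vol E / sqrt (deg E i * deg E f) * green_sum i f)"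
    using deg_pos[of f] by (simp add: G_def stationary_def real_sqrt_mult divide_simps)
  finally show ?thesis .
qed

lemma T_mix_eq: "enn2ereal (T_mix E) = ereal (Max (range mixing_cost))"
proof -
  have "T_mix E = Max (ennreal ` range mixing_cost)"
    by (simp add: T_mix_def H_pi_eq image_image)
  also have "\<dots> = ennreal (Max (range mixing_cost))"
    by (rule mono_Max_commute[symmetric]) (auto simp: mono_def ennreal_leI)
  moreover have "0 \<le> Max (range mixing_cost)"
    using mixing_cost_nonneg by (simp add: Max_ge_iff)
  ultimately show ?thesis
    by simp
qed

lemma T_reset_eq: "enn2ereal (T_reset E) = ereal (\<Sum>i\<in>UNIV. \<pi> i * mixing_cost i)"
proof -
  have nonneg: "0 \<le> \<pi> i * mixing_cost i" for i
    using \<pi>_pos[of i] mixing_cost_nonneg[of i] by simp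
  have "T_reset E = ennreal (\<Sum>i\<in>UNIV. \<pi> i * mixing_cost i)"
    unfolding T_reset_def H_pi_eq using \<pi>_pos nonneg
    by (simp add: less_imp_le flip: ennreal_mult')
  then show ?thesis
    using nonneg by (simp add: sum_nonneg)
qed

text \<open>Averaging over the starting vertex removes the terms \<open>G i k\<close>, since
  \<open>\<pi>\<close> annihilates \<open>G\<close>; what remains is the trace of
  \<open>G\<close>.\<close>

lemma T_hit_eq: "enn2ereal (T_hit E) = ereal (\<Sum>k = 1..CARD('n) - 1. 1 / lam k)"
proof -
  let ?f = "\<lambda>i k. \<pi> i * \<pi> k * ((G k k - G i k) / \<pi> k)"
  have nonneg: "0 \<le> ?f i k" for i k
    using \<pi>_pos[of i] \<pi>_pos[of k] by (intro mult_nonneg_nonneg mean_hitting_eq(2)) auto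
  have "T_hit E = ennreal (\<Sum>i\<in>UNIV. \<Sum>k\<in>UNIV. ?f i k)"
  proof -
    have "ennreal (\<pi> i * \<pi> k) * mean_hitting E i k = ennreal (?f i k)" for i k
      unfolding mean_hitting_eq(1) using \<pi>_pos[of i] \<pi>_pos[of k] by (intro ennreal_mult'[symmetric]) simp
    then show ?thesis
      unfolding T_hit_def using nonneg by (simp add: sum_nonneg)
  qed
  moreover have "(\<Sum>i\<in>UNIV. \<Sum>k\<in>UNIV. ?f i k) = (\<Sum>k = 1..CARD('n) - 1. 1 / lam k)"
  proof -
    have "?f i k = \<pi> i * (G k k - G i k)" for i k
      using \<pi>_pos[of k] by simp
    then have "?f i k = \<pi> i * G k k - \<pi> i * G i k" for i k
      by (simp only: right_diff_distrib)
    then have "(\<Sum>i\<in>UNIV. \<Sum>k\<in>UNIV. ?f i k) =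
        (\<Sum>i\<in>UNIV. \<Sum>k\<in>UNIV. \<pi> i * G k k) - (\<Sum>i\<in>UNIV. \<Sum>k\<in>UNIV. \<pi> i * G i k)"
      by (simp only: sum_subtractf)
    also have "(\<Sum>i\<in>UNIV. \<Sum>k\<in>UNIV. \<pi> i * G k k) = (\<Sum>i\<in>UNIV. \<pi> i) * (\<Sum>k\<in>UNIV. G k k)"
      by (rule sum_product[symmetric])
    also have "(\<Sum>i\<in>UNIV. \<Sum>k\<in>UNIV. \<pi> i * G i k) = (\<Sum>k\<in>UNIV. \<Sum>i\<in>UNIV. \<pi> i * G i k)"
      by (rule sum.swap)
    finally show ?thesis
      by (simp add: sum_\<pi> sum_\<pi>_G trace_G)
  qed
  moreover have "0 \<le> (\<Sum>i\<in>UNIV. \<Sum>k\<in>UNIV. ?f i k)"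
    by (intro sum_nonneg nonneg)
  ultimately show ?thesis
    by (metis enn2ereal_ennreal)
qed

end

theorem theorem2:
  fixes E :: "'n::finite \<Rightarrow> 'n \<Rightarrow> bool"
    and lam :: "nat \<Rightarrow> real"
    and \<phi> :: "nat \<Rightarrow> real^'n"
    and far :: "'n \<Rightarrow> 'n"
  assumes "2 \<le> CARD('n)"
    and "simple_graph E"
    and "connected_graph E"
    and "lam 0 = 0"
    and "0 < lam 1"
    and "\<And>k. 1 \<le> k \<Longrightarrow> Suc k < CARD('n) \<Longrightarrow> lam k \<le> lam (Suc k)"
    and "\<And>k. k < CARD('n) \<Longrightarrow> normalized_laplacian E *v \<phi> k = lam k *\<^sub>R \<phi> k"
    and "\<And>k l. k < CARD('n) \<Longrightarrow> l < CARD('n) \<Longrightarrow> \<phi> k \<bullet> \<phi> l = (if k = l then 1 else 0)"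
    and "\<And>i. mean_hitting E (far i) i = Max (range (\<lambda>j. mean_hitting E j i))"
  shows "(\<forall>i j. green E $ i $ j =
      sqrt (real (deg E j) / real (deg E i)) *
        (\<Sum>k = 1..CARD('n) - 1. 1 / lam k * \<phi> k $ i * \<phi> k $ j))
    \<and> enn2ereal (T_mix E) = ereal (Max (range (\<lambda>i.
      - (real (vol E) / sqrt (real (deg E i) * real (deg E (far i))) *
        (\<Sum>k = 1..CARD('n) - 1. 1 / lam k * \<phi> k $ i * \<phi> k $ far i)))))
    \<and> enn2ereal (T_reset E) = ereal (- (\<Sum>i\<in>UNIV.
      sqrt (real (deg E i) / real (deg E (far i))) *
        (\<Sum>k = 1..CARD('n) - 1. 1 / lam k * \<phi> k $ i * \<phi> k $ far i)))
    \<and> enn2ereal (T_hit E) = ereal (\<Sum>k = 1..CARD('n) - 1. 1 / lam k)"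
proof -
  interpret graph_spectrum E lam \<phi>
  proof
    show "E u v \<Longrightarrow> E v u" for u v
      using assms(2) by (auto simp: simple_graph_def dest: sympD)
    show "0 < deg E v" for v
    proof -
      \<comment> \<open>A second vertex forces a nonempty path out of \<open>v\<close>, whose first
        edge makes the degree positive.\<close>
      have "\<exists>w. w \<noteq> v"
      proof (rule ccontr)
        assume "\<nexists>w. w \<noteq> v"
        then have "(UNIV :: 'n set) = {v}"
          by auto
        then have "CARD('n) = card {v}"
          by (rule arg_cong)
        with assms(1) show False
          by simp
      qed
      then obtain w where "w \<noteq> v" by blast
      moreover have "E\<^sup>*\<^sup>* v w"
        using assms(3) by (simp add: connected_graph_def)
      ultimately obtain u where "E v u"
        by (metis converse_rtranclpE)
      then show ?thesis
        by (auto simp: deg_def card_gt_0_iff)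
    qed
    show "0 < lam k" if "1 \<le> k" "k < CARD('n)" for k
      using that
    proof (induction k rule: dec_induct)
      case base
      then show ?case using assms(5) by simp
    next
      case (step k)
      then show ?case using assms(6)[of k] by simp
    qed
  qed (use assms in auto)
  have cost: "mixing_cost i = - (vol E / sqrt (deg E i * deg E (far i)) * green_sum i (far i))" for i
    by (rule mixing_cost_farthest[OF assms(9)])
  have reset: "(\<Sum>i\<in>UNIV. \<pi> i * mixing_cost i) =
      - (\<Sum>i\<in>UNIV. sqrt (deg E i / deg E (far i)) * green_sum i (far i))"
    unfolding sum_negf[symmetric]
  proof (rule sum.cong[OF refl])
    fix i
    have "\<pi> i * (vol E / sqrt (deg E i * deg E (far i))) =
        deg E i / sqrt (deg E i) / sqrt (deg E (far i))"
      using vol_pos by (simp add: stationary_def real_sqrt_mult)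
    also have "\<dots> = sqrt (deg E i / deg E (far i))"
      by (simp only: real_div_sqrt of_nat_0_le_iff real_sqrt_divide)
    finally have ratio: "\<pi> i * (vol E / sqrt (deg E i * deg E (far i))) =
        sqrt (deg E i / deg E (far i))" .
    show "\<pi> i * mixing_cost i = - (sqrt (deg E i / deg E (far i)) * green_sum i (far i))"
      unfolding cost mult_minus_right mult.assoc[symmetric] ratio ..
  qed
  show ?thesis
    unfolding green_sum_def[symmetric]
  proof (intro conjI allI)
    show "green E $ i $ j = sqrt (deg E j / deg E i) * green_sum i j" for i j
      by (simp add: green_eq G_def real_sqrt_divide)
    show "enn2ereal (T_mix E) = ereal (Max (range (\<lambda>i.
        - (vol E / sqrt (real (deg E i) * real (deg E (far i))) * green_sum i (far i)))))"
      unfolding T_mix_eq cost[symmetric] by (simp add: cost)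
    show "enn2ereal (T_reset E) =
        ereal (- (\<Sum>i\<in>UNIV. sqrt (deg E i / deg E (far i)) * green_sum i (far i)))"
      unfolding T_reset_eq reset ..
  qed (rule T_hit_eq)
qed

end
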